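(* Let $c\in(0,1)$, let $\gamma\in[0,1)$ be a fixed parameter, and let $\delta\in(0,\Delta]$. Consider the two-type bandit problem with an endogenous arm-reservoir described in the context, with $g(u)=c(u+1)^{-\gamma}$ for $u\geqslant0$. Then the expected cumulative regret of the policy $\pi$ given by Algorithm ALG1$(n,\delta)$ satisfies $$\limsup_{n\to\infty}\frac{\mathbb{E}R_n^{\pi}}{\log n}\leqslant\left(\frac{48\Delta}{\delta^2}\right)\left(\frac{4}{c}\right)^{\frac{1}{1-\gamma}}\left(\left\lceil\frac{\gamma}{1-\gamma}\right\rceil\right)!.$$
   Context: Bandit problem. There are two arm-types, $\mathcal{K}=\{1,2\}$, with mean rewards $\mu_1>\mu_2$; the gap is $\Delta:=\mu_1-\mu_2>0$. Type 1 is called optimal, type 2 inferior. One arm is played at each time $t\in\{1,\dots,n\}$, where $n$ is the horizon of play. At time $t$ one either replays a previously played arm or plays a new arm queried from the reservoir. An arm queried at time $t$ is of type 1 with probability $\alpha(t)$ and of type 2 otherwise. Types are never observed. The $j$-th pull of arm $i$ yields a $[0,1]$-valued reward $X_{i,j}$ whose mean is $\mu_k$ if arm $i$ has type $k$; rewards are independent across arms and time (for a fixed arm they have a constant mean but need not be identically distributed). $N_i(t)$ denotes the number of pulls of arm $i$ up to time $t$. Regret. For a policy $\pi$ playing arm $\pi_t$ at time $t$, $R_n^{\pi}:=\sum_{t=1}^{n}(\mu_1-X_{\pi_t,N_{\pi_t}(t)})$; $\mathbb{E}R_n^\pi=\mathbb{E}\sum_{t=1}^{n}(\mu_1-\mu_{\kappa(\pi_t)})$,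 where $\kappa(\pi_t)\in\{1,2\}$ is the type of the arm played at time $t$. Expectations are over rewards, policy randomization and reservoir randomness. Endogenous reservoir (Model 2): $\alpha(t)=g(\mathcal{J}_{t-1})$, where $g:\mathbb{N}\cup\{0\}\to(0,c]$ is a non-increasing deterministic mapping with $g(0)=c\in(0,1)$, and $\mathcal{J}_t$ is the number of reservoir queries made up to and including time $t$, with $\mathcal{J}_0:=0$. Algorithm ALG1$(n,\delta)$ (non-adaptive Explore-then-Commit), with inputs the horizon $n$ and a gap parameter $\delta\in(0,\Delta]$: set $m=\lceil 2\delta^{-2}\log n\rceil$. Start a new epoch: query and play two new arms from the reservoir at two consecutive times (call them arms 1 and 2), then play each of them $m-1$ more times, observing rewards $X_{1,j},X_{2,j}$, $j=1,\dots,m$. If $\left|\sum_{j=1}^{m}(X_{1,j}-X_{2,j})\right|<\delta m$, permanently discard both arms and start a new epoch (with two new arms). Otherwise, commit for all remaining times to an arm $i^*\in\arg\max_{i\in\{1,2\}}\sum_{j=1}^mX_{i,j}$ (ties broken arbitrarily). The procedure stops after $n$ total plays.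
   Formalization: For δ = Δ the claim fails for some non-identically distributed rewards; there it is assumed that the rewards of at least one type have variances bounded below by a positive constant, or that all rewards are noiseless. This always holds if reward laws depend only on the type. *)

theory Defs
  imports "HOL-Probability.Probability"
begin

section \<open>Environment: arm types, rewards and the reservoir\<close>

datatype arm_type = Optimal | Inferior

text \<open>
  Arms are labelled 0, 1, 2, ... in the order in which they are queried. A sample point assigns to
  each label \<open>i\<close> the (unobserved) type of arm \<open>i\<close> and its reward sequence \<open>X i 1, X i 2, ...\<close>; the
  entry at index 0 of a reward sequence is never used.
\<close>

type_synonym sample = "nat \<Rightarrow> arm_type \<times> (nat \<Rightarrow> real)"

definition reward :: "sample \<Rightarrow> nat \<Rightarrow> nat \<Rightarrow> real" where
  "reward \<omega> i j = snd (\<omega> i) j"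

text \<open>
  \<open>\<nu> i k j\<close> is the law of the \<open>j\<close>-th reward of arm \<open>i\<close> when that arm has type \<open>k\<close>. Only the mean is
  fixed by the type: the laws may vary with the arm and with the pull.
\<close>

definition reward_laws ::
    "(arm_type \<Rightarrow> real) \<Rightarrow> (nat \<Rightarrow> arm_type \<Rightarrow> nat \<Rightarrow> real measure) \<Rightarrow> bool" where
  "reward_laws \<mu> \<nu> \<longleftrightarrow>
     (\<forall>i k j. prob_space (\<nu> i k j) \<and> sets (\<nu> i k j) = sets borel
        \<and> (AE x in \<nu> i k j. x \<in> {0..1}) \<and> (\<integral>x. x \<partial>\<nu> i k j) = \<mu> k)"

definition type_pmf :: "real \<Rightarrow> arm_type pmf" where
  "type_pmf p = map_pmf (\<lambda>b. if b then Optimal else Inferior) (bernoulli_pmf p)"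

text \<open>
  Joint law of type and rewards of one arm: the type is \<open>Optimal\<close> with probability \<open>p\<close>, and given
  type \<open>k\<close> the rewards are independent with laws \<open>L k j\<close>.
\<close>

definition arm_law ::
    "real \<Rightarrow> (arm_type \<Rightarrow> nat \<Rightarrow> real measure) \<Rightarrow> (arm_type \<times> (nat \<Rightarrow> real)) measure" where
  "arm_law p L = measure_pmf (type_pmf p) \<bind>
     (\<lambda>k. distr (Pi\<^sub>M UNIV (L k)) (count_space UNIV \<Otimes>\<^sub>M Pi\<^sub>M UNIV (\<lambda>_. borel)) (Pair k))"

text \<open>
  Endogenous reservoir: an arm queried at time \<open>t\<close> is \<open>Optimal\<close> with probability \<open>g (J (t - 1))\<close>,
  where \<open>J (t - 1)\<close> is the number of earlier queries. This number is exactly the label which the arm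
  receives (see \<open>history\<close> below), so the arm with label \<open>i\<close> is \<open>Optimal\<close> with probability \<open>g i\<close>,
  whatever the time of the query and whatever happened before.
\<close>

definition bandit :: "(nat \<Rightarrow> real) \<Rightarrow> (nat \<Rightarrow> arm_type \<Rightarrow> nat \<Rightarrow> real measure) \<Rightarrow> sample measure" where
  "bandit g \<nu> = Pi\<^sub>M UNIV (\<lambda>i. arm_law (g i) (\<nu> i))"


section \<open>Policies and regret\<close>

text \<open>
  One entry \<open>(q, i, x)\<close> per play, in chronological order: \<open>q\<close> tells whether the arm was queried from
  the reservoir at that time, \<open>i\<close> is the label of the arm and \<open>x\<close> the reward received.
\<close>

type_synonym history = "(bool \<times> nat \<times> real) list"

datatype action = Query | Replay nat

type_synonym policy = "history \<Rightarrow> action"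

definition queries :: "history \<Rightarrow> nat" where
  "queries h = length (filter (\<lambda>(q, i, x). q) h)"

definition observed :: "history \<Rightarrow> nat \<Rightarrow> real list" where
  "observed h i = map (\<lambda>(q, a, x). x) (filter (\<lambda>(q, a, x). a = i) h)"

definition pulls :: "history \<Rightarrow> nat \<Rightarrow> nat" where
  "pulls h i = length (observed h i)"

text \<open>The history up to and including time \<open>t\<close> when \<open>\<pi>\<close> is run on the sample point \<open>\<omega>\<close>.\<close>

fun history :: "policy \<Rightarrow> sample \<Rightarrow> nat \<Rightarrow> history" where
  "history \<pi> \<omega> 0 = []"
| "history \<pi> \<omega> (Suc t) =
     (let h = history \<pi> \<omega> t in
      case \<pi> h of
        Query \<Rightarrow> h @ [(True, queries h, reward \<omega> (queries h) (Suc (pulls h (queries h))))]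
      | Replay i \<Rightarrow> h @ [(False, i, reward \<omega> i (Suc (pulls h i)))])"

definition arm_played :: "policy \<Rightarrow> sample \<Rightarrow> nat \<Rightarrow> nat" where
  "arm_played \<pi> \<omega> t = fst (snd (last (history \<pi> \<omega> t)))"

definition regret :: "(arm_type \<Rightarrow> real) \<Rightarrow> policy \<Rightarrow> sample \<Rightarrow> nat \<Rightarrow> real" where
  "regret \<mu> \<pi> \<omega> n =
     (\<Sum>t = 1..n. \<mu> Optimal -
        reward \<omega> (arm_played \<pi> \<omega> t) (pulls (history \<pi> \<omega> t) (arm_played \<pi> \<omega> t)))"

definition expected_regret ::
    "(arm_type \<Rightarrow> real) \<Rightarrow> (nat \<Rightarrow> real) \<Rightarrow> (nat \<Rightarrow> arm_type \<Rightarrow> nat \<Rightarrow> real measure) \<Rightarrow>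
     policy \<Rightarrow> nat \<Rightarrow> real" where
  "expected_regret \<mu> g \<nu> \<pi> n = (\<integral>\<omega>. regret \<mu> \<pi> \<omega> n \<partial>bandit g \<nu>)"


section \<open>The non-adaptive Explore-then-Commit algorithm\<close>

definition epoch_pulls :: "nat \<Rightarrow> real \<Rightarrow> nat" where
  "epoch_pulls n \<delta> = nat \<lceil>2 * ln (real n) / \<delta>\<^sup>2\<rceil>"

text \<open>
  The two arms of the current epoch are the two most recently queried ones, \<open>a\<close> and \<open>b\<close>; the number
  of queries is odd exactly between the two queries which open an epoch. The sums \<open>S a\<close> and \<open>S b\<close>
  involve the first \<open>m\<close> rewards only, so that a decision to commit is never revised. For
  \<open>n \<ge> 2\<close> we have \<open>m \<ge> 1\<close>, and then committing requires \<open>\<bar>S a - S b\<bar> \<ge> \<delta> * m > 0\<close>; hence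
  the final comparison never has to break a tie.
\<close>

definition alg1 :: "nat \<Rightarrow> real \<Rightarrow> policy" where
  "alg1 n \<delta> h =
     (let m = epoch_pulls n \<delta>;
          J = queries h;
          a = J - 2;
          b = J - 1;
          S = (\<lambda>i. sum_list (take m (observed h i)))
      in if J = 0 \<or> odd J then Query
         else if pulls h a < m then Replay a
         else if pulls h b < m then Replay b
         else if \<bar>S a - S b\<bar> < \<delta> * real m then Query
         else Replay (if S a \<ge> S b then a else b))"


section \<open>Reward noise in the boundary case\<close>

definition reward_var :: "(arm_type \<Rightarrow> real) \<Rightarrow> (nat \<Rightarrow> arm_type \<Rightarrow> nat \<Rightarrow> real measure) \<Rightarrow>
    nat \<Rightarrow> arm_type \<Rightarrow> nat \<Rightarrow> real" where
  "reward_var \<mu> \<nu> i k j = (\<integral>x. (x - \<mu> k)\<^sup>2 \<partial>\<nu> i k j)"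

text \<open>
  When \<open>\<delta> = \<mu> Optimal - \<mu> Inferior\<close>, the threshold \<open>\<delta> * m\<close> is the exact mean of the test statistic
  for an optimal against an inferior arm, so that the test passes with probability bounded away from
  0 only if the statistic has no extremely skewed fluctuations of bounded size. For example, let
  \<open>\<mu> Inferior = 0\<close>, and let the first reward of every optimal arm be 1 with probability
  \<open>\<epsilon> = \<mu> Optimal\<close> and 0 otherwise, all its later rewards being equal to \<open>\<epsilon>\<close>. Then an optimal arm
  passes against an inferior one with probability \<open>\<epsilon>\<close> only, however large \<open>m\<close> is, and regret
  bounds which are uniform in the reward laws fail. The following condition excludes such laws: the
  rewards of at least one type have variance bounded away from 0, or there is no noise at all.
\<close>

definition nondegenerate_noise ::
    "(arm_type \<Rightarrow> real) \<Rightarrow> (nat \<Rightarrow> arm_type \<Rightarrow> nat \<Rightarrow> real measure) \<Rightarrow> bool" where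
  "nondegenerate_noise \<mu> \<nu> \<longleftrightarrow>
     (\<exists>k. \<exists>v>0. \<forall>i j. v \<le> reward_var \<mu> \<nu> i k j) \<or> (\<forall>i k j. reward_var \<mu> \<nu> i k j = 0)"

text \<open>The condition always holds if the reward law depends on the type of the arm only.\<close>

lemma nondegenerate_noise_iid:
  assumes "\<And>i k j. \<nu> i k j = F k"
  shows "nondegenerate_noise \<mu> \<nu>"
proof (cases "\<forall>k. (\<integral>x. (x - \<mu> k)\<^sup>2 \<partial>F k) = 0")
  case True
  then show ?thesis
    by (simp add: nondegenerate_noise_def reward_var_def assms)
next
  case False
  then obtain k where "(\<integral>x. (x - \<mu> k)\<^sup>2 \<partial>F k) \<noteq> 0"
    by blast
  moreover have "0 \<le> (\<integral>x. (x - \<mu> k)\<^sup>2 \<partial>F k)"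
    by (intro integral_nonneg_AE) simp
  ultimately have "0 < (\<integral>x. (x - \<mu> k)\<^sup>2 \<partial>F k)"
    by linarith
  then show ?thesis
    unfolding nondegenerate_noise_def reward_var_def assms by blast
qed

end

theory Submission
  imports Defs "HOL-Probability.Hoeffding" "HOL-Real_Asymp.Real_Asymp"
begin

text \<open>
  Epoch \<open>k\<close> uses the fresh arms \<open>2 * k\<close> and \<open>2 * k + 1\<close>, so whether it is reached is independent of
  its arms. Hence exploration costs \<open>m * \<Delta>\<close> times the sum over \<open>k\<close> of \<open>u k * P k\<close>, where \<open>P k\<close> is the
  probability of reaching epoch \<open>k\<close> and \<open>u k = 2 - g (2 * k) - g (2 * k + 1)\<close> is its expected number
  of inferior arms. By Hoeffding's inequality an inferior arm wins its epoch with probability at most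
  \<open>1 / n\<close>, so all the plays after a commitment cost together at most \<open>\<Delta>\<close> times the same sum.

  If the types of the two arms differ, the test passes with probability at least \<open>1 / 7\<close> once \<open>m\<close> is
  large; in the boundary case \<open>\<delta> = \<Delta>\<close> this follows from second and fourth moments. Therefore
  \<open>P (k + 1) \<le> P k * (1 - g (2 * k + 1) * u k / 7)\<close>. The sum of \<open>u k * P k\<close> is bounded by a
  supersolution of the corresponding linear recursion: in the variable \<open>y = (2 * k + 2) powr (1 - \<gamma>)\<close>
  the epoch of the commitment has at most an exponential tail, and the supersolution is a moment of order
  \<open>\<lceil>\<gamma> / (1 - \<gamma>)\<rceil>\<close> of an exponential variable, which is the source of the factorial.
\<close>

section \<open>Epoch count\<close>

text \<open>For \<open>c\<close> close to 1 most early epochs draw two optimal arms, which may fail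
  the test almost always, so the expected number of epochs admits no bound of the desired form. Such
  epochs cost next to nothing, however. Therefore the expected number \<open>u k\<close> of inferior
  arms is kept as a factor on both sides: as the cost, and inside the passing probability
  \<open>x k = g (2 * k + 1) * u k / 7\<close>. Then \<open>u k = x k * (7 / c) * y powr r\<close>
  with \<open>r = \<gamma> / (1 - \<gamma>)\<close>, and the sum of \<open>u k * P k\<close> is,
  formally, the mean of \<open>(7 / c) * y powr r\<close> at the epoch of commitment. The scale
  \<open>y\<close> is the one in which the factor \<open>v k powr (- \<gamma>)\<close>, common to
  the passing probability and to the step of \<open>y\<close>, cancels and leaves a constant rate.

  The prefactor \<open>14 / c\<close> is \<open>7 / c\<close> times the 2 in
  \<open>1 + s! <= 2 * s!\<close>. Against the target \<open>24 * (4 / c) powr (1 + r)\<close> it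
  leaves \<open>48 / 7 * (4 / c) powr r\<close> for the power of \<open>M\<close>, the number that
  all later numerical estimates have to meet.\<close>

lemma powr_le_Bernoulli:
  fixes t p :: real
  assumes "0 < t" "0 \<le> p" "p \<le> 1"
  shows "t powr p \<le> 1 + p * (t - 1)"
  using Youngs_inequality_0[of p "1 - p" t 1] assms by (simp add: algebra_simps)

lemma powr_add_le_add_powr:
  fixes x y r :: real
  assumes "0 < x" "0 < y" "0 \<le> r" "r \<le> 1"
  shows "(x + y) powr r \<le> x powr r + y powr r"
proof -
  have *: "z / (x + y) \<le> (z / (x + y)) powr r" if "0 < z" "z \<le> x + y" for z
    using powr_mono'[of r 1 "z / (x + y)"] that assms by simp
  have "1 = x / (x + y) + y / (x + y)"
    using assms by (simp flip: add_divide_distrib)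
  also have "\<dots> \<le> (x / (x + y)) powr r + (y / (x + y)) powr r"
    using *[of x] *[of y] assms by simp
  also have "\<dots> = (x powr r + y powr r) / (x + y) powr r"
    using assms by (simp add: powr_divide add_divide_distrib)
  finally show ?thesis
    using assms by (simp add: le_divide_eq)
qed

text \<open>Trades the real exponent for an integer one, so that polynomial moments become
  available. The additive 1 covers \<open>t <= 1\<close>.\<close>

lemma powr_le_one_plus_power:
  fixes t r :: real
  assumes "0 < t" "0 \<le> r" "r \<le> real s"
  shows "t powr r \<le> 1 + t ^ s"
proof (cases "t \<le> 1")
  case True
  then have "t powr r \<le> 1" using assms by (simp add: powr_le1)
  then show ?thesis using assms(1) zero_le_power[of t s] by linarith
next
  case False
  then have "t powr r \<le> t powr real s" using assms by (intro powr_mono) auto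
  then show ?thesis using assms by (simp add: powr_realpow)
qed

lemma power_diff_le_tangent:
  fixes x y :: real
  assumes "0 \<le> x" "x \<le> y"
  shows "y ^ Suc s - x ^ Suc s \<le> real (Suc s) * y ^ s * (y - x)"
proof (induction s)
  case 0
  then show ?case by simp
next
  case (Suc s)
  have "y ^ Suc (Suc s) - x ^ Suc (Suc s) = y * (y ^ Suc s - x ^ Suc s) + (y - x) * x ^ Suc s"
    by (simp add: algebra_simps)
  also have "\<dots> \<le> y * (real (Suc s) * y ^ s * (y - x)) + (y - x) * y ^ Suc s"
    using assms Suc by (intro add_mono mult_left_mono power_mono) auto
  also have "\<dots> = real (Suc (Suc s)) * y ^ Suc s * (y - x)"
    by (simp add: algebra_simps)
  finally show ?case .
qed

text \<open>\<open>P N * h N\<close> is a reserve for the cost still to come: the cost already paid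
  plus this reserve never exceeds \<open>h 0\<close>.\<close>

lemma sum_le_supersolution:
  fixes u x P h :: "nat \<Rightarrow> real"
  assumes P: "P 0 \<le> 1" "\<And>k. 0 \<le> P k" "\<And>k. P (Suc k) \<le> P k * (1 - x k)"
    and h: "\<And>k. 0 \<le> h k" "\<And>k. u k + (1 - x k) * h (Suc k) \<le> h k"
  shows "(\<Sum>k<N. u k * P k) \<le> h 0"
proof -
  have "(\<Sum>k<N. u k * P k) + P N * h N \<le> h 0"
  proof (induction N)
    case 0
    then show ?case using mult_right_mono[OF P(1) h(1)[of 0]] by simp
  next
    case (Suc N)
    have "u N * P N + P (Suc N) * h (Suc N) \<le> u N * P N + P N * (1 - x N) * h (Suc N)"
      using P(3) h(1) by (intro add_left_mono mult_right_mono) auto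
    also have "\<dots> = P N * (u N + (1 - x N) * h (Suc N))"
      by (simp add: algebra_simps)
    also have "\<dots> \<le> P N * h N"
      using P(2) h(2) by (intro mult_left_mono)
    finally show ?case using Suc by simp
  qed
  moreover have "0 \<le> P N * h N" using P h by simp
  ultimately show ?thesis by linarith
qed

text \<open>The polynomial solution of \<open>H - \<theta> * H' = y ^ s\<close>, that is, the mean of \<open>(y + E) ^ s\<close> for an
  exponential variable \<open>E\<close> of mean \<open>\<theta>\<close>.\<close>

fun exp_moment :: "real \<Rightarrow> nat \<Rightarrow> real \<Rightarrow> real" where
  "exp_moment \<theta> 0 y = 1"
| "exp_moment \<theta> (Suc s) y = y ^ Suc s + real (Suc s) * \<theta> * exp_moment \<theta> s y"

lemma exp_moment_ge_power: "0 \<le> \<theta> \<Longrightarrow> 0 \<le> y \<Longrightarrow> y ^ s \<le> exp_moment \<theta> s y"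
proof (induction s)
  case (Suc s)
  have "0 \<le> exp_moment \<theta> s y"
    using Suc zero_le_power[of y s] by linarith
  then show ?case using Suc by simp
qed simp

text \<open>The moment is a binomial sum with an extra \<open>j!\<close> at
  \<open>\<theta> ^ j\<close>; replacing each \<open>j!\<close> by \<open>s!\<close> restores the
  binomial formula.\<close>

lemma exp_moment_le:
  assumes "0 \<le> \<theta>" "0 \<le> y"
  shows "exp_moment \<theta> s y \<le> fact s * (y + \<theta>) ^ s"
proof (induction s)
  case 0
  then show ?case by simp
next
  case (Suc s)
  have "y ^ s \<le> (y + \<theta>) ^ s"
    using assms by (intro power_mono) auto
  also have "\<dots> \<le> fact (Suc s) * (y + \<theta>) ^ s"
    using assms mult_right_mono[OF fact_ge_1[of "Suc s", where 'a = real], of "(y + \<theta>) ^ s"] by simp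
  finally have "y ^ Suc s \<le> y * (fact (Suc s) * (y + \<theta>) ^ s)"
    using assms by (simp add: mult_left_mono del: fact_Suc)
  moreover have "real (Suc s) * \<theta> * exp_moment \<theta> s y \<le> real (Suc s) * \<theta> * (fact s * (y + \<theta>) ^ s)"
    using assms Suc by (intro mult_left_mono) auto
  ultimately show ?case by (simp add: algebra_simps)
qed

text \<open>Difference form of the equation \<open>\<theta> * H' = H - y ^ s\<close>: by convexity
  the mean slope is at most the derivative at the right end. The right end is the useful one because
  the recursion weights the value at \<open>Suc k\<close>.\<close>

lemma exp_moment_diff_le:
  assumes "0 \<le> \<theta>" "0 \<le> x" "x \<le> y"
  shows "\<theta> * (exp_moment \<theta> s y - exp_moment \<theta> s x) \<le> (y - x) * (exp_moment \<theta> s y - y ^ s)"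
proof (induction s)
  case 0
  then show ?case by simp
next
  case (Suc s)
  have "\<theta> * (exp_moment \<theta> (Suc s) y - exp_moment \<theta> (Suc s) x)
      = \<theta> * (y ^ Suc s - x ^ Suc s) + real (Suc s) * \<theta> * (\<theta> * (exp_moment \<theta> s y - exp_moment \<theta> s x))"
    by (simp add: algebra_simps)
  also have "\<dots> \<le> \<theta> * (real (Suc s) * y ^ s * (y - x)) +
      real (Suc s) * \<theta> * ((y - x) * (exp_moment \<theta> s y - y ^ s))"
    using assms Suc by (intro add_mono mult_left_mono power_diff_le_tangent) auto
  also have "\<dots> = (y - x) * (exp_moment \<theta> (Suc s) y - y ^ Suc s)"
    by (simp add: algebra_simps)
  finally show ?case .
qed

text \<open>
  From epoch \<open>k0\<close> on every arm is inferior with probability at least \<open>1 / 2\<close>, which bounds the drift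
  uniformly; before \<open>k0\<close> a constant supersolution suffices.
\<close>

lemma reservoir_drift:
  fixes c \<gamma> :: real
  assumes c: "0 < c" "c < 1" and gamma: "0 < \<gamma>" "\<gamma> < 1"
    and g: "\<And>u. g u = c * (real u + 1) powr (- \<gamma>)"
    and P: "P 0 \<le> 1" "\<And>k. 0 \<le> P k"
      "\<And>k. P (Suc k) \<le> P k * (1 - g (2 * k + 1) * (2 - g (2 * k) - g (2 * k + 1)) / 7)"
    and k0: "2 \<le> (2 * real k0 + 1) powr \<gamma>"
  defines "r \<equiv> \<gamma> / (1 - \<gamma>)"
  defines "M \<equiv> (2 * real k0 + 2) powr (1 - \<gamma>) + 14 * (1 - \<gamma>) / c"
  shows "(\<Sum>k<N. (2 - g (2 * k) - g (2 * k + 1)) * P k) \<le> 14 / c * M powr r * fact (nat \<lceil>r\<rceil>)"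
proof -
  define s where "s = nat \<lceil>r\<rceil>"
  \<comment> \<open>Quotient of the largest step of \<open>y\<close>,
    \<open>2 * (1 - \<gamma>) * v k powr (- \<gamma>)\<close>, by the passing probability per unit
    of \<open>u k\<close>, \<open>c / 7 * v k powr (- \<gamma>)\<close>.\<close>
  define \<theta> where "\<theta> = 14 * (1 - \<gamma>) / c"
  define v where "v k = 2 * real k + 2" for k :: nat
  define y where "y k = v k powr (1 - \<gamma>)" for k
  define F where "F k = 7 / c * M powr r * (1 + exp_moment \<theta> s (y k) / M ^ s)" for k
  define u where "u k = 2 - g (2 * k) - g (2 * k + 1)" for k
  have r: "0 < r" "r \<le> real s"
    using gamma by (simp_all add: r_def s_def)
  have theta: "0 < \<theta>" using c gamma by (simp add: \<theta>_def)
  have v: "2 \<le> v k" for k by (simp add: v_def)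
  have y: "1 \<le> y k" for k
    unfolding y_def using v[of k] gamma by (intro ge_one_powr_ge_zero) auto
  have M: "M = y k0 + \<theta>" by (simp add: M_def y_def v_def \<theta>_def)
  with y[of k0] theta have M_pos: "0 < M" by linarith
  have y_r: "y k powr r = v k powr \<gamma>" for k
    using gamma by (simp add: y_def powr_powr r_def)
  have g_odd: "g (2 * k + 1) = c * v k powr (- \<gamma>)" for k
    by (simp add: g v_def add.commute)
  have g_le1: "g k \<le> c" for k
    unfolding g using c gamma powr_mono[of "-\<gamma>" 0 "real k + 1"] by simp
  have g_pos: "0 < g k" for k using c by (simp add: g)
  have u_pos: "0 < u k" for k
    using g_le1[of "2 * k"] g_le1[of "2 * k + 1"] c by (simp add: u_def)
  have H_pos: "0 \<le> exp_moment \<theta> s (y k)" for k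
    using exp_moment_ge_power[of \<theta> "y k" s] theta y[of k] zero_le_power[of "y k" s] by linarith
  have F_ge: "7 / c * M powr r \<le> F k" for k
    unfolding F_def using H_pos[of k] M_pos c by (simp add: field_simps)
  have F_pos: "0 \<le> F k" for k
    using F_ge[of k] c by (meson divide_nonneg_pos mult_nonneg_nonneg order_trans powr_ge_zero zero_le_numeral)
  \<comment> \<open>A constant has no increment, so the passing probability alone must pay for the
    cost; this holds as long as \<open>y k <= M\<close>.\<close>
  have early: "u k \<le> g (2 * k + 1) * u k / 7 * F k0" if "k \<le> k0" for k
  proof -
    have "v k powr \<gamma> \<le> v k0 powr \<gamma>"
      using that gamma v[of k] by (intro powr_mono2) (auto simp: v_def)
    also have "\<dots> \<le> M powr r"
      using r y[of k0] theta unfolding y_r[symmetric] M by (intro powr_mono2) auto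
    finally have "1 \<le> v k powr (- \<gamma>) * M powr r"
      using v[of k] by (simp add: powr_minus field_simps)
    also have "\<dots> = g (2 * k + 1) / 7 * (7 / c * M powr r)"
      unfolding g_odd using c by simp
    also have "\<dots> \<le> g (2 * k + 1) / 7 * F k0"
      using F_ge g_pos[of "2 * k + 1"] by (intro mult_left_mono) auto
    finally show ?thesis
      using mult_left_mono[of 1 "g (2 * k + 1) / 7 * F k0" "u k"] u_pos[of k] by (simp add: mult_ac)
  qed
  have late: "u k + F (Suc k) - F k \<le> g (2 * k + 1) * u k / 7 * F (Suc k)" if k: "k0 \<le> k" for k
  proof -
    have g_half: "g j \<le> 1 / 2" if "2 * k \<le> j" for j
    proof -
      have "2 \<le> (real j + 1) powr \<gamma>"
        using that k gamma by (intro order_trans[OF k0] powr_mono2) auto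
      then have "c \<le> 1 / 2 * (real j + 1) powr \<gamma>" using c by linarith
      then show ?thesis by (simp add: g powr_minus field_simps)
    qed
    \<comment> \<open>The increment of \<open>F\<close> carries no factor \<open>u k\<close>,
      whereas the passing probability does; \<open>u k >= 1\<close> lets the latter absorb
      it.\<close>
    have u1: "1 \<le> u k"
      using g_half[of "2 * k"] g_half[of "2 * k + 1"] by (simp add: u_def)
    define V where "V = v k powr (- \<gamma>)"
    define H where "H = exp_moment \<theta> s (y (Suc k)) - y (Suc k) ^ s"
    have V: "0 < V" using v[of k] by (simp add: V_def)
    have H: "0 \<le> H"
      unfolding H_def using exp_moment_ge_power[of \<theta> "y (Suc k)" s] theta y[of "Suc k"] by simp
    have yk: "y k \<le> y (Suc k)"
      unfolding y_def using gamma v[of k] by (intro powr_mono2) (auto simp: v_def)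
    have "v (Suc k) = v k * (1 + 2 / v k)"
      using v[of k] by (simp add: distrib_left) (simp add: v_def)
    then have "y (Suc k) = (v k * (1 + 2 / v k)) powr (1 - \<gamma>)"
      by (simp add: y_def)
    also have "\<dots> = v k powr (1 - \<gamma>) * (1 + 2 / v k) powr (1 - \<gamma>)"
      using v[of k] by (subst powr_mult) auto
    also have "\<dots> \<le> v k powr (1 - \<gamma>) * (1 + (1 - \<gamma>) * (1 + 2 / v k - 1))"
      using gamma add_pos_pos[OF zero_less_one, of "2 / v k"] v[of k]
      by (intro mult_left_mono powr_le_Bernoulli) auto
    also have "\<dots> = y k + 2 * (1 - \<gamma>) * V"
      using v[of k] by (simp add: y_def V_def algebra_simps powr_diff powr_minus divide_simps)
    finally have dy: "y (Suc k) - y k \<le> 2 * (1 - \<gamma>) * V" by simp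
    have "\<theta> * (exp_moment \<theta> s (y (Suc k)) - exp_moment \<theta> s (y k)) \<le> (y (Suc k) - y k) * H"
      unfolding H_def using theta y[of k] yk by (intro exp_moment_diff_le) auto
    also have "\<dots> \<le> 2 * (1 - \<gamma>) * V * H"
      using dy H by (rule mult_right_mono)
    also have "\<dots> = \<theta> * (c / 7 * V * H)"
      using c by (simp add: \<theta>_def field_simps)
    finally have dH: "exp_moment \<theta> s (y (Suc k)) - exp_moment \<theta> s (y k) \<le> c / 7 * V * H"
      using theta by simp
    have "F (Suc k) - F k = 7 / c * M powr r * ((exp_moment \<theta> s (y (Suc k)) - exp_moment \<theta> s (y k)) / M ^ s)"
      by (simp add: F_def algebra_simps diff_divide_distrib)
    also have "\<dots> \<le> 7 / c * M powr r * ((c / 7 * V * H) / M ^ s)"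
      using dH c M_pos by (intro mult_left_mono divide_right_mono) auto
    also have "\<dots> = M powr r * V * (H / M ^ s)"
      using c by (simp add: field_simps)
    finally have dF: "F (Suc k) - F k \<le> M powr r * V * (H / M ^ s)" .
    have "v k powr \<gamma> \<le> y (Suc k) powr r"
      unfolding y_r using gamma v[of k] by (intro powr_mono2) (auto simp: v_def)
    also have "\<dots> = M powr r * (y (Suc k) / M) powr r"
      using M_pos y[of "Suc k"] by (simp add: powr_divide)
    also have "\<dots> \<le> M powr r * (1 + (y (Suc k) / M) ^ s)"
      using M_pos y[of "Suc k"] r by (intro mult_left_mono powr_le_one_plus_power) auto
    finally have "V * v k powr \<gamma> \<le> V * (M powr r * (1 + (y (Suc k) / M) ^ s))"
      using V by simp
    moreover have "V * v k powr \<gamma> = 1"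
      using v[of k] by (simp add: V_def powr_minus)
    ultimately have one: "1 \<le> V * M powr r * (1 + (y (Suc k) / M) ^ s)"
      by (simp add: mult_ac)
    have "u k + F (Suc k) - F k \<le> u k * 1 + 1 * (M powr r * V * (H / M ^ s))"
      using dF by simp
    also have "\<dots> \<le> u k * (V * M powr r * (1 + (y (Suc k) / M) ^ s)) + u k * (M powr r * V * (H / M ^ s))"
      using one u1 V H M_pos by (intro add_mono mult_left_mono mult_right_mono) auto
    also have "\<dots> = V * u k * (M powr r * (1 + exp_moment \<theta> s (y (Suc k)) / M ^ s))"
      by (simp add: H_def algebra_simps power_divide diff_divide_distrib)
    also have "\<dots> = g (2 * k + 1) * u k / 7 * F (Suc k)"
      unfolding g_odd F_def V_def using c by (simp add: field_simps)
    finally show ?thesis .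
  qed
  \<comment> \<open>The supersolution is \<open>F (max k k0)\<close>, frozen at \<open>F k0\<close>
    before epoch \<open>k0\<close>.\<close>
  have "(\<Sum>k<N. u k * P k) \<le> F (max 0 k0)"
  proof (rule sum_le_supersolution)
    show "P (Suc k) \<le> P k * (1 - g (2 * k + 1) * u k / 7)" for k
      using P(3)[of k] by (simp add: u_def)
    show "u k + (1 - g (2 * k + 1) * u k / 7) * F (max (Suc k) k0) \<le> F (max k k0)" for k
    proof (cases "k < k0")
      case True
      with early[of k] show ?thesis by (simp add: max_def algebra_simps)
    next
      case False
      with late[of k] show ?thesis by (simp add: max_def algebra_simps)
    qed
  qed (use P F_pos in auto)
  also have "\<dots> = F k0" by simp
  also have "\<dots> \<le> 7 / c * M powr r * (1 + fact s)"
  proof -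
    \<comment> \<open>The choice \<open>M = y k0 + \<theta>\<close> makes the power in the moment
      bound cancel exactly.\<close>
    have "exp_moment \<theta> s (y k0) / M ^ s \<le> fact s"
      using exp_moment_le[of \<theta> "y k0" s] theta y[of k0] M_pos
      by (simp add: M field_simps)
    then show ?thesis
      unfolding F_def using c by (intro mult_left_mono add_left_mono) auto
  qed
  also have "\<dots> \<le> 7 / c * M powr r * (2 * fact s)"
    using c fact_ge_1[of s, where 'a = real] by (intro mult_left_mono) auto
  also have "\<dots> = 14 / c * M powr r * fact s" by simp
  finally show ?thesis by (simp add: u_def s_def)
qed

section \<open>Numerical constants of the epoch count\<close>

lemma reservoir_constant_small:
  fixes c \<gamma> v :: real
  assumes c: "0 < c" "c < 1" and gamma: "0 < \<gamma>" "\<gamma> \<le> 1 / 2" and v: "1 \<le> v" "v powr \<gamma> \<le> 4"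
  defines "r \<equiv> \<gamma> / (1 - \<gamma>)"
  shows "(v powr (1 - \<gamma>) + 14 * (1 - \<gamma>) / c) powr r \<le> 48 / 7 * (4 / c) powr r"
proof -
  have r: "0 < r" "r \<le> 1" using gamma by (simp_all add: r_def)
  have one: "1 \<le> (4 / c) powr r" using c r by (intro ge_one_powr_ge_zero) auto
  have "r * (7 / 2 * (1 - \<gamma>) - 1) \<le> 3 / 2"
  proof -
    have "3 / 2 * (1 - \<gamma>) - \<gamma> * (7 / 2 * (1 - \<gamma>) - 1) = 7 / 2 * (\<gamma> - 4 / 7)\<^sup>2 + 5 / 14"
      by (simp add: power2_eq_square field_simps)
    then have "\<gamma> * (7 / 2 * (1 - \<gamma>) - 1) \<le> 3 / 2 * (1 - \<gamma>)"
      using zero_le_power2[of "\<gamma> - 4 / 7"] by linarith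
    then have "\<gamma> * (7 / 2 * (1 - \<gamma>) - 1) / (1 - \<gamma>) \<le> 3 / 2"
      by (rule mult_imp_div_pos_le[rotated]) (use gamma in simp)
    then show ?thesis by (simp only: r_def times_divide_eq_left)
  qed
  moreover have "(7 / 2 * (1 - \<gamma>)) powr r \<le> 1 + r * (7 / 2 * (1 - \<gamma>) - 1)"
    using gamma r by (intro powr_le_Bernoulli) auto
  ultimately have b: "(7 / 2 * (1 - \<gamma>)) powr r \<le> 5 / 2" by linarith
  \<comment> \<open>Since \<open>r <= 1\<close>, the power is subadditive. In units of
    \<open>(4 / c) powr r\<close> the two summands cost at most 4 and 5/2, together 13/2 <
    48/7.\<close>
  have "(v powr (1 - \<gamma>) + 14 * (1 - \<gamma>) / c) powr r \<le> (v powr (1 - \<gamma>)) powr r + (14 * (1 - \<gamma>) / c) powr r"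
    using v gamma c r by (intro powr_add_le_add_powr) auto
  also have "(v powr (1 - \<gamma>)) powr r = v powr \<gamma>"
    using gamma by (simp add: powr_powr r_def)
  also have "(14 * (1 - \<gamma>) / c) powr r = (4 / c) powr r * (7 / 2 * (1 - \<gamma>)) powr r"
  proof -
    have "14 * (1 - \<gamma>) / c = (4 / c) * (7 / 2 * (1 - \<gamma>))" using c by (simp add: field_simps)
    then show ?thesis using c gamma by (simp only:) (subst powr_mult, auto)
  qed
  also have "v powr \<gamma> + \<dots> \<le> 4 * (4 / c) powr r + (4 / c) powr r * (5 / 2)"
    using v one b by (intro add_mono mult_left_mono) auto
  also have "\<dots> \<le> 48 / 7 * (4 / c) powr r" using one by simp
  finally show ?thesis .
qed

text \<open>Now \<open>r\<close> is unbounded, so the base may exceed \<open>4 / c\<close> only by a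
  factor \<open>exp (C / r)\<close>. The slope 19 is 5, from the Bernoulli bound for
  \<open>6 powr p\<close>, plus 14; the value \<open>C = 19 / 10\<close> is large enough for all
  \<open>p <= 1 / 2\<close> and still satisfies \<open>exp C <= 48 / 7\<close>.\<close>

lemma reservoir_constant_large:
  fixes c \<gamma> :: real
  assumes c: "0 < c" "c < 1" and gamma: "1 / 2 \<le> \<gamma>" "\<gamma> < 1"
  defines "r \<equiv> \<gamma> / (1 - \<gamma>)"
  shows "(6 powr (1 - \<gamma>) + 14 * (1 - \<gamma>) / c) powr r \<le> 48 / 7 * (4 / c) powr r"
proof -
  define p where "p = 1 - \<gamma>"
  have p: "0 < p" "p \<le> 1 / 2" using gamma by (simp_all add: p_def)
  have r: "r = (1 - p) / p" "0 < r" using gamma by (simp_all add: r_def p_def)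
  have "6 powr p \<le> 1 + p * (6 - 1)" using p by (intro powr_le_Bernoulli) auto
  also have "\<dots> \<le> (1 + p * (6 - 1)) / c" using c p by (simp add: le_divide_eq)
  finally have "6 powr p + 14 * p / c \<le> (1 + 19 * p) / c" by (simp add: add_divide_distrib)
  also have "\<dots> = 4 / c * ((1 + 19 * p) / 4)" using c by (simp add: field_simps)
  also have "\<dots> \<le> 4 / c * exp (19 / 10 / r)"
  proof (intro mult_left_mono)
    have "(1 + 19 * p) * (1 - p) \<le> 4 * (1 - p) + 76 / 10 * p"
    proof -
      \<comment> \<open>Completed square of \<open>19 * p^2 - 14.4 * p + 3\<close>, the difference
        of the two sides.\<close>
      have "0 \<le> 19 * (p - 72 / 190)\<^sup>2 + (3 - 19 * (72 / 190)\<^sup>2)"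
        by (simp add: power2_eq_square)
      then show ?thesis by (simp add: power2_eq_square algebra_simps)
    qed
    then have "(1 + 19 * p) / 4 \<le> 1 + 19 / 10 / r"
      using p by (simp add: r field_simps)
    also have "\<dots> \<le> exp (19 / 10 / r)" by (rule exp_ge_add_one_self)
    finally show "(1 + 19 * p) / 4 \<le> exp (19 / 10 / r)" .
  qed (use c in auto)
  finally have "(6 powr p + 14 * p / c) powr r \<le> (4 / c * exp (19 / 10 / r)) powr r"
    using r p c by (intro powr_mono2) auto
  also have "\<dots> = (4 / c) powr r * exp (19 / 10)"
  proof -
    have "exp (19 / 10 / r) powr r = exp (19 / 10)"
      using r(2) by (simp add: exp_powr_real)
    then show ?thesis using c by (subst powr_mult) auto
  qed
  also have "exp (19 / 10 :: real) \<le> 48 / 7"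
  proof -
    have "exp (19 / 10 :: real) * exp (1 / 10) = exp 1 * exp 1"
      by (simp flip: exp_add)
    also have "\<dots> \<le> 272 / 100 * (272 / 100)"
      using e_less_272 by (intro mult_mono) auto
    finally have "exp (19 / 10 :: real) * exp (1 / 10) \<le> 272 / 100 * (272 / 100)" .
    moreover have "exp (19 / 10 :: real) * (1 + 1 / 10) \<le> exp (19 / 10) * exp (1 / 10)"
      by (intro mult_left_mono exp_ge_add_one_self) auto
    ultimately have "exp (19 / 10 :: real) * (1 + 1 / 10) \<le> 272 / 100 * (272 / 100)"
      by (rule order_trans[rotated])
    then show ?thesis by simp
  qed
  finally show ?thesis using c by (simp add: p_def mult.commute)
qed

lemma reservoir_sum_le:
  fixes c \<gamma> :: real
  assumes c: "0 < c" "c < 1" and gamma: "0 \<le> \<gamma>" "\<gamma> < 1"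
    and g: "\<And>u. g u = c * (real u + 1) powr (- \<gamma>)"
    and P: "P 0 \<le> 1" "\<And>k. 0 \<le> P k"
      "\<And>k. P (Suc k) \<le> P k * (1 - g (2 * k + 1) * (2 - g (2 * k) - g (2 * k + 1)) / 7)"
  shows "(\<Sum>k<N. (2 - g (2 * k) - g (2 * k + 1)) * P k)
    \<le> 24 * (4 / c) powr (1 / (1 - \<gamma>)) * fact (nat \<lceil>\<gamma> / (1 - \<gamma>)\<rceil>)"
proof (cases "\<gamma> = 0")
  case True
  \<comment> \<open>With a constant reservoir the cost is exactly \<open>7 / c\<close> times the
    passing probability, so a constant supersolution is sharp.\<close>
  have "(\<Sum>k<N. (2 - g (2 * k) - g (2 * k + 1)) * P k) \<le> (\<lambda>_. 7 / c) (0 :: nat)"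
    by (rule sum_le_supersolution[where x = "\<lambda>k. g (2 * k + 1) * (2 - g (2 * k) - g (2 * k + 1)) / 7"])
      (use P c True in \<open>auto simp: g field_simps\<close>)
  also have "\<dots> \<le> 24 * (4 / c)" using c by (simp add: divide_right_mono)
  finally show ?thesis using True c by simp
next
  case False
  with gamma have gamma: "0 < \<gamma>" "\<gamma> < 1" by auto
  define r where "r = \<gamma> / (1 - \<gamma>)"
  have "\<exists>k0. 2 \<le> (2 * real k0 + 1) powr \<gamma> \<and>
    ((2 * real k0 + 2) powr (1 - \<gamma>) + 14 * (1 - \<gamma>) / c) powr r \<le> 48 / 7 * (4 / c) powr r"
  proof (cases "\<gamma> \<le> 1 / 2")
    case True
    \<comment> \<open>Minimality bounds \<open>k0\<close> from above: its predecessor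
      \<open>j\<close> violates the condition, and \<open>2 * k0 + 2 <= 4 * (2 * j + 1)\<close>,
      whence \<open>(2 * k0 + 2) powr \<gamma> <= 4\<close>.\<close>
    define k0 where "k0 = (LEAST k. 2 \<le> (2 * real k + 1) powr \<gamma>)"
    obtain k1 :: nat where "2 powr (1 / \<gamma>) \<le> real k1"
      using real_arch_simple by blast
    then have "(2 powr (1 / \<gamma>)) powr \<gamma> \<le> (2 * real k1 + 1) powr \<gamma>"
      using gamma by (intro powr_mono2) auto
    then have "2 \<le> (2 * real k1 + 1) powr \<gamma>"
      using gamma by (simp add: powr_powr)
    then have k0: "2 \<le> (2 * real k0 + 1) powr \<gamma>"
      unfolding k0_def by (rule LeastI)
    then obtain j where j: "k0 = Suc j"
      by (cases k0) auto
    have "\<not> 2 \<le> (2 * real j + 1) powr \<gamma>"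
      using not_less_Least[of j "\<lambda>k. 2 \<le> (2 * real k + 1) powr \<gamma>"] j by (simp add: k0_def)
    then have less: "(2 * real j + 1) powr \<gamma> < 2" by simp
    have "(2 * real k0 + 2) powr \<gamma> \<le> (4 * (2 * real j + 1)) powr \<gamma>"
      using j gamma by (intro powr_mono2) auto
    also have "\<dots> = 4 powr \<gamma> * (2 * real j + 1) powr \<gamma>"
      by (subst powr_mult) auto
    also have "\<dots> \<le> 4 powr (1 / 2) * 2"
      using less gamma True by (intro mult_mono powr_mono) auto
    also have "\<dots> = 4" by (simp add: powr_half_sqrt)
    finally show ?thesis
      using k0 reservoir_constant_small[OF c gamma(1) True, of "2 * real k0 + 2"] by (auto simp: r_def)
  next
    case False
    \<comment> \<open>Here \<open>k0 = 2\<close> serves all \<open>\<gamma>\<close> at once; it is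
      the source of the base \<open>6 = 2 * k0 + 2\<close> in the estimate for large
      \<open>\<gamma>\<close>.\<close>
    have "(2::real) \<le> 5 powr (1 / 2)"
      by (simp add: powr_half_sqrt real_le_rsqrt)
    also have "\<dots> \<le> 5 powr \<gamma>" using False by (intro powr_mono) auto
    finally show ?thesis
      using reservoir_constant_large[OF c _ gamma(2)] False by (intro exI[of _ 2]) (auto simp: r_def)
  qed
  then obtain k0 where k0: "2 \<le> (2 * real k0 + 1) powr \<gamma>"
    and M: "((2 * real k0 + 2) powr (1 - \<gamma>) + 14 * (1 - \<gamma>) / c) powr r \<le> 48 / 7 * (4 / c) powr r"
    by blast
  have "(\<Sum>k<N. (2 - g (2 * k) - g (2 * k + 1)) * P k) \<le>
      14 / c * ((2 * real k0 + 2) powr (1 - \<gamma>) + 14 * (1 - \<gamma>) / c) powr r * fact (nat \<lceil>r\<rceil>)"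
    unfolding r_def by (rule reservoir_drift[OF c gamma g P k0])
  also have "\<dots> \<le> 14 / c * (48 / 7 * (4 / c) powr r) * fact (nat \<lceil>r\<rceil>)"
    using M c by (intro mult_right_mono mult_left_mono) auto
  also have "\<dots> = 24 * ((4 / c) powr 1 * (4 / c) powr r) * fact (nat \<lceil>r\<rceil>)"
    using c by simp
  also have "(4 / c) powr 1 * (4 / c) powr r = (4 / c) powr (1 + r)"
    by (simp only: powr_add)
  also have "1 + r = 1 / (1 - \<gamma>)" using gamma by (simp add: r_def field_simps)
  finally show ?thesis by (simp add: r_def)
qed

section \<open>Sums of independent bounded variables\<close>

text \<open>For a standardised variable with fourth moment at most \<open>3 + 1 / V\<close> the left
  side has mean at least \<open>3 / 20 - 1 / (20 * V)\<close>, which is \<open>1 / 7\<close> at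
  \<open>V = 7\<close>. The linear term has mean zero; it pulls the polynomial below 0 for small
  negative \<open>x\<close>, where the quadratic term alone would be positive.\<close>

lemma quartic_le_indicator:
  fixes x :: real
  shows "29 / 100 * x + 3 / 10 * x\<^sup>2 - 1 / 20 * x ^ 4 \<le> (if 0 \<le> x then 1 else 0)"
proof (cases "0 \<le> x")
  case True
  have "20 - (29 / 5 * x + 6 * x\<^sup>2 - x ^ 4)
      = (x\<^sup>2 - 37 / 10)\<^sup>2 + 7 / 5 * (x - 29 / 14)\<^sup>2 + (631 / 100 - 7 / 5 * (29 / 14)\<^sup>2)"
    by (simp add: power2_eq_square power4_eq_xxxx field_simps)
  also have "\<dots> \<ge> 0" by (intro add_nonneg_nonneg) (simp_all add: power2_eq_square)
  finally show ?thesis using True by simp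
next
  case False
  define t where "t = - x"
  have t: "0 < t" using False by (simp add: t_def)
  \<comment> \<open>The number \<open>142 / 100\<close> approximates \<open>sqrt 2\<close>, the
    positive minimiser of \<open>t^3 - 6 * t + 58 / 10\<close>.\<close>
  have "0 \<le> t * ((t - 142 / 100)\<^sup>2 * (t + 284 / 100) + (3 * (142 / 100)\<^sup>2 - 6) * t + (58 / 10 - 2 * (142 / 100) ^ 3))"
    using t by (intro mult_nonneg_nonneg add_nonneg_nonneg) (auto simp: power2_eq_square power3_eq_cube)
  also have "\<dots> = 58 / 10 * t - 6 * t\<^sup>2 + t ^ 4"
    by (simp add: power2_eq_square power3_eq_cube power4_eq_xxxx field_simps)
  finally show ?thesis using False by (simp add: t_def)
qed

context prob_space
begin

lemma integrable_power_AE_bounded: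
  fixes Z :: "'a \<Rightarrow> real"
  assumes "random_variable borel Z" "AE x in M. \<bar>Z x\<bar> \<le> B"
  shows "integrable M (\<lambda>x. Z x ^ k)"
proof (rule integrable_const_bound)
  show "AE x in M. norm (Z x ^ k) \<le> B ^ k"
    using assms(2) by eventually_elim (simp add: power_abs power_mono)
qed (use assms(1) in simp)

lemma indep_var_expectation_mult_power:
  fixes Y Z :: "'a \<Rightarrow> real"
  assumes ind: "indep_var borel Y borel Z"
    and b: "AE x in M. \<bar>Y x\<bar> \<le> B" "AE x in M. \<bar>Z x\<bar> \<le> C"
  shows "expectation (\<lambda>x. Y x ^ a * Z x ^ b) = expectation (\<lambda>x. Y x ^ a) * expectation (\<lambda>x. Z x ^ b)"
    and "integrable M (\<lambda>x. Y x ^ a * Z x ^ b)"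
proof -
  have "indep_var borel ((\<lambda>y. y ^ a) \<circ> Y) borel ((\<lambda>y. y ^ b) \<circ> Z)"
    by (intro indep_var_compose[OF ind]) auto
  then have ind': "indep_var borel (\<lambda>x. Y x ^ a) borel (\<lambda>x. Z x ^ b)" by (simp add: comp_def)
  have int: "integrable M (\<lambda>x. Y x ^ a)" "integrable M (\<lambda>x. Z x ^ b)"
    using indep_var_rv1[OF ind] indep_var_rv2[OF ind] b by (auto intro: integrable_power_AE_bounded)
  show "expectation (\<lambda>x. Y x ^ a * Z x ^ b) = expectation (\<lambda>x. Y x ^ a) * expectation (\<lambda>x. Z x ^ b)"
    "integrable M (\<lambda>x. Y x ^ a * Z x ^ b)"
    using indep_var_lebesgue_integral[OF ind' int] indep_var_integrable[OF ind' int] by auto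
qed

lemma AE_abs_sum_le_card:
  fixes Y :: "'i \<Rightarrow> 'a \<Rightarrow> real"
  assumes "finite I" "\<And>i. i \<in> I \<Longrightarrow> AE x in M. \<bar>Y i x\<bar> \<le> 1"
  shows "AE x in M. \<bar>\<Sum>i\<in>I. Y i x\<bar> \<le> real (card I)"
proof -
  have "AE x in M. \<forall>i\<in>I. \<bar>Y i x\<bar> \<le> 1"
    using assms by (simp add: AE_ball_countable countable_finite)
  then show ?thesis
  proof eventually_elim
    case (elim x)
    have "\<bar>\<Sum>i\<in>I. Y i x\<bar> \<le> (\<Sum>i\<in>I. \<bar>Y i x\<bar>)" by (rule sum_abs)
    also have "\<dots> \<le> (\<Sum>i\<in>I. 1)" using elim by (intro sum_mono) auto
    finally show ?case by simp
  qed
qed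

text \<open>The term \<open>3 * (V I)\<^sup>2\<close> is the Gaussian fourth moment; the excess
  \<open>V I\<close> comes from fourth moments of the summands, at most their variances as
  \<open>\<bar>Y i\<bar> <= 1\<close>. In the induction step all mixed terms with an odd power
  vanish, and the remaining one is the cross term of the square.\<close>

lemma indep_sum_moments:
  fixes Y :: "'i \<Rightarrow> 'a \<Rightarrow> real"
  assumes "finite I" "indep_vars (\<lambda>_. borel) Y I"
    and "\<And>i. i \<in> I \<Longrightarrow> AE x in M. \<bar>Y i x\<bar> \<le> 1"
    and "\<And>i. i \<in> I \<Longrightarrow> expectation (Y i) = 0"
  defines "V \<equiv> \<lambda>I. \<Sum>i\<in>I. expectation (\<lambda>x. (Y i x)\<^sup>2)"
  shows "expectation (\<lambda>x. \<Sum>i\<in>I. Y i x) = 0 \<and> expectation (\<lambda>x. (\<Sum>i\<in>I. Y i x)\<^sup>2) = V I \<and>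
    expectation (\<lambda>x. (\<Sum>i\<in>I. Y i x) ^ 4) \<le> 3 * (V I)\<^sup>2 + V I"
  using assms(1-4)
proof (induction I)
  case empty
  then show ?case by (simp add: V_def)
next
  case (insert i I)
  define Z where "Z x = (\<Sum>i\<in>I. Y i x)" for x
  define v where "v = expectation (\<lambda>x. (Y i x)\<^sup>2)"
  have rv[measurable]: "random_variable borel (Y j)" if "j \<in> insert i I" for j
    using insert.prems(1) that by (auto simp: indep_vars_def)
  have ind: "indep_var borel (Y i) borel Z"
    unfolding Z_def using insert.hyps insert.prems(1) by (rule indep_vars_sum)
  have Yb: "AE x in M. \<bar>Y i x\<bar> \<le> 1" using insert.prems(2) by simp
  have Zb: "AE x in M. \<bar>Z x\<bar> \<le> real (card I)"
    unfolding Z_def using insert by (intro AE_abs_sum_le_card) auto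
  note E = indep_var_expectation_mult_power[OF ind Yb Zb]
  have IH: "expectation Z = 0" "expectation (\<lambda>x. (Z x)\<^sup>2) = V I"
    "expectation (\<lambda>x. Z x ^ 4) \<le> 3 * (V I)\<^sup>2 + V I"
    using insert.IH indep_vars_subset[OF insert.prems(1), of I] insert.prems unfolding Z_def by auto
  have Y0: "expectation (Y i) = 0" using insert.prems(3) by simp
  have int[simp]: "integrable M (\<lambda>x. Y i x ^ a)" "integrable M (\<lambda>x. Z x ^ a)" for a
    using Yb Zb indep_var_rv1[OF ind] indep_var_rv2[OF ind] by (auto intro: integrable_power_AE_bounded)
  have [simp]: "integrable M (Y i)" "integrable M Z" using int[of 1] by simp_all
  have V: "V (insert i I) = V I + v" using insert.hyps by (simp add: V_def v_def)
  have "0 \<le> V I" "0 \<le> v" unfolding V_def v_def by (auto intro!: sum_nonneg)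
  have S: "(\<Sum>j\<in>insert i I. Y j x) = Y i x + Z x" for x
    using insert.hyps by (simp add: Z_def)
  have "expectation (\<lambda>x. Y i x ^ 4) \<le> v"
    unfolding v_def
  proof (rule integral_mono_AE)
    show "AE x in M. Y i x ^ 4 \<le> (Y i x)\<^sup>2"
      using Yb
    proof eventually_elim
      case (elim x)
      then have "(Y i x)\<^sup>2 * (Y i x)\<^sup>2 \<le> (Y i x)\<^sup>2 * 1"
        by (intro mult_left_mono) (auto simp: abs_square_le_1)
      then show ?case by (simp flip: power_add)
    qed
  qed auto
  have "expectation (\<lambda>x. (Y i x + Z x)\<^sup>2)
      = expectation (\<lambda>x. (Y i x)\<^sup>2 + 2 * (Y i x ^ 1 * Z x ^ 1) + (Z x)\<^sup>2)"
    by (intro Bochner_Integration.integral_cong) (auto simp: power2_eq_square algebra_simps)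
  also have "\<dots> = v + V I"
    using E[of 1 1] by (simp add: v_def IH Y0)
  finally have E2: "expectation (\<lambda>x. (Y i x + Z x)\<^sup>2) = V I + v" by simp
  have "expectation (\<lambda>x. (Y i x + Z x) ^ 4) = expectation (\<lambda>x. Y i x ^ 4 + 4 * (Y i x ^ 3 * Z x ^ 1)
      + 6 * (Y i x ^ 2 * Z x ^ 2) + 4 * (Y i x ^ 1 * Z x ^ 3) + Z x ^ 4)"
    by (intro Bochner_Integration.integral_cong)
       (auto simp: power2_eq_square power3_eq_cube power4_eq_xxxx algebra_simps)
  also have "\<dots> = expectation (\<lambda>x. Y i x ^ 4) + 6 * (v * V I) + expectation (\<lambda>x. Z x ^ 4)"
    using E(1)[of 3 1] E(2)[of 3 1] E(1)[of 2 2] E(2)[of 2 2] E(1)[of 1 3] E(2)[of 1 3]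
    by (simp add: v_def IH Y0)
  also have "\<dots> \<le> v + 6 * (v * V I) + (3 * (V I)\<^sup>2 + V I)"
    using IH(3) \<open>expectation (\<lambda>x. Y i x ^ 4) \<le> v\<close> by linarith
  also have "\<dots> \<le> 3 * (V I + v)\<^sup>2 + (V I + v)"
    by (simp add: power2_eq_square algebra_simps)
  finally show ?case
    using E2 by (simp add: S V IH Y0)
qed

text \<open>A quartic minorant of the indicator of the half-line replaces a central limit theorem here.\<close>

lemma prob_indep_sum_nonneg:
  fixes Y :: "'i \<Rightarrow> 'a \<Rightarrow> real"
  assumes fin: "finite I" and ind: "indep_vars (\<lambda>_. borel) Y I"
    and b: "\<And>i. i \<in> I \<Longrightarrow> AE x in M. \<bar>Y i x\<bar> \<le> 1"
    and mean: "\<And>i. i \<in> I \<Longrightarrow> expectation (Y i) = 0"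
    and var: "7 \<le> (\<Sum>i\<in>I. expectation (\<lambda>x. (Y i x)\<^sup>2))"
  shows "1 / 7 \<le> prob {x \<in> space M. 0 \<le> (\<Sum>i\<in>I. Y i x)}"
proof -
  define Z where "Z x = (\<Sum>i\<in>I. Y i x)" for x
  define V where "V = (\<Sum>i\<in>I. expectation (\<lambda>x. (Y i x)\<^sup>2))"
  have V: "7 \<le> V" using var by (simp add: V_def)
  have mom: "expectation Z = 0" "expectation (\<lambda>x. (Z x)\<^sup>2) = V" "expectation (\<lambda>x. Z x ^ 4) \<le> 3 * V\<^sup>2 + V"
    using indep_sum_moments[OF fin ind b mean] unfolding Z_def V_def by auto
  have [measurable]: "random_variable borel (Y i)" if "i \<in> I" for i
    using ind that by (auto simp: indep_vars_def)
  have Zm[measurable]: "random_variable borel Z" unfolding Z_def by measurable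
  have Zb: "AE x in M. \<bar>Z x\<bar> \<le> real (card I)"
    unfolding Z_def by (intro AE_abs_sum_le_card fin b)
  have int[simp]: "integrable M (\<lambda>x. Z x ^ a)" for a
    by (intro integrable_power_AE_bounded[OF Zm Zb])
  have [simp]: "integrable M Z" using int[of 1] by simp
  define w where "w = 29 / 100 / sqrt V"
  have "1 / 7 \<le> 3 / 10 - 1 / 20 * (3 * V\<^sup>2 + V) / V\<^sup>2"
    using V by (simp add: field_simps power2_eq_square)
  also have "\<dots> \<le> 3 / 10 - 1 / 20 * expectation (\<lambda>x. Z x ^ 4) / V\<^sup>2"
    using mom(3) by (intro diff_left_mono divide_right_mono mult_left_mono) auto
  also have "\<dots> = expectation (\<lambda>x. w * Z x + 3 / 10 / V * (Z x)\<^sup>2 - 1 / 20 / V\<^sup>2 * Z x ^ 4)"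
    using V by (simp add: mom)
  also have "\<dots> \<le> expectation (indicator {x \<in> space M. 0 \<le> Z x})"
  proof (rule integral_mono)
    fix x assume x: "x \<in> space M"
    have "w * Z x + 3 / 10 / V * (Z x)\<^sup>2 - 1 / 20 / V\<^sup>2 * Z x ^ 4
        = 29 / 100 * (Z x / sqrt V) + 3 / 10 * (Z x / sqrt V)\<^sup>2 - 1 / 20 * (Z x / sqrt V) ^ 4"
      using V power_mult[of "sqrt V" 2 2] by (simp add: w_def power_divide)
    also have "\<dots> \<le> (if 0 \<le> Z x / sqrt V then 1 else 0)" by (rule quartic_le_indicator)
    also have "\<dots> = indicator {x \<in> space M. 0 \<le> Z x} x"
      using V x by (simp add: zero_le_divide_iff)
    finally show "w * Z x + 3 / 10 / V * (Z x)\<^sup>2 - 1 / 20 / V\<^sup>2 * Z x ^ 4 \<le> indicator {x \<in> space M. 0 \<le> Z x} x" .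
  qed (auto simp: less_top[symmetric])
  finally show ?thesis by (simp add: Z_def)
qed

end

section \<open>Runs of the algorithm\<close>

definition reward_sum :: "nat \<Rightarrow> sample \<Rightarrow> nat \<Rightarrow> real" where
  "reward_sum m \<omega> i = (\<Sum>j = 1..m. reward \<omega> i j)"

text \<open>Defined for every sample point, even if the run never reaches epoch \<open>e\<close>; it
  thus involves two fixed arms only and is independent of the earlier epochs.\<close>

definition epoch_fails :: "nat \<Rightarrow> real \<Rightarrow> sample \<Rightarrow> nat \<Rightarrow> bool" where
  "epoch_fails m \<delta> \<omega> e \<longleftrightarrow> \<bar>reward_sum m \<omega> (2 * e) - reward_sum m \<omega> (2 * e + 1)\<bar> < \<delta> * real m"

text \<open>Zero-based: the arm pulled at time \<open>Suc t\<close>, chosen from the history of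
  length \<open>t\<close>.\<close>

definition played :: "policy \<Rightarrow> sample \<Rightarrow> nat \<Rightarrow> nat" where
  "played \<pi> \<omega> t = (case \<pi> (history \<pi> \<omega> t) of Query \<Rightarrow> queries (history \<pi> \<omega> t) | Replay i \<Rightarrow> i)"

lemma observed_snoc: "observed (h @ [(q, a, x)]) i = observed h i @ (if a = i then [x] else [])"
  by (simp add: observed_def)

lemma pulls_snoc: "pulls (h @ [(q, a, x)]) i = pulls h i + (if a = i then 1 else 0)"
  by (simp add: pulls_def observed_snoc)

lemma queries_snoc: "queries (h @ [(q, a, x)]) = queries h + (if q then 1 else 0)"
  by (simp add: queries_def)

lemma history_Suc:
  "history \<pi> \<omega> (Suc t) = history \<pi> \<omega> t @
     [(\<pi> (history \<pi> \<omega> t) = Query, played \<pi> \<omega> t,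
       reward \<omega> (played \<pi> \<omega> t) (Suc (pulls (history \<pi> \<omega> t) (played \<pi> \<omega> t))))]"
  by (simp add: played_def Let_def split: action.split)

declare history.simps(2) [simp del]

lemma queries_Nil [simp]: "queries [] = 0" and pulls_Nil [simp]: "pulls [] i = 0"
  by (simp_all add: queries_def pulls_def observed_def)

lemma pulls_history_Suc:
  "pulls (history \<pi> \<omega> (Suc t)) i = pulls (history \<pi> \<omega> t) i + (if played \<pi> \<omega> t = i then 1 else 0)"
  by (simp add: history_Suc pulls_snoc)

lemma queries_history_Suc:
  "queries (history \<pi> \<omega> (Suc t)) =
     queries (history \<pi> \<omega> t) + (if \<pi> (history \<pi> \<omega> t) = Query then 1 else 0)"
  by (simp add: history_Suc queries_snoc)

lemma regret_eq:
  "regret \<mu> \<pi> \<omega> n = (\<Sum>t<n. \<mu> Optimal -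
     reward \<omega> (played \<pi> \<omega> t) (Suc (pulls (history \<pi> \<omega> t) (played \<pi> \<omega> t))))"
proof -
  have "regret \<mu> \<pi> \<omega> n = (\<Sum>t<n. \<mu> Optimal -
      reward \<omega> (arm_played \<pi> \<omega> (Suc t)) (pulls (history \<pi> \<omega> (Suc t)) (arm_played \<pi> \<omega> (Suc t))))"
    unfolding regret_def by (rule sum.reindex_bij_witness[of _ Suc "\<lambda>t. t - 1"]) auto
  then show ?thesis
    by (simp add: arm_played_def history_Suc pulls_snoc)
qed

lemma observed_history:
  "observed (history \<pi> \<omega> t) i = map (reward \<omega> i) [1..<Suc (pulls (history \<pi> \<omega> t) i)]"
proof (induction t)
  case 0
  then show ?case by (simp add: observed_def pulls_def)
next
  case (Suc t)
  then show ?case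
    by (simp add: history_Suc observed_snoc pulls_snoc)
qed

lemma sum_list_take_observed:
  assumes "m \<le> pulls (history \<pi> \<omega> t) i"
  shows "sum_list (take m (observed (history \<pi> \<omega> t) i)) = reward_sum m \<omega> i"
proof -
  have "take m (observed (history \<pi> \<omega> t) i) = map (reward \<omega> i) [1..<Suc m]"
    using assms by (subst observed_history) (simp add: take_map take_upt del: upt_Suc)
  then show ?thesis
    by (simp add: reward_sum_def interv_sum_list_conv_sum_set_nat atLeastLessThanSuc_atLeastAtMost del: upt_Suc)
qed

section \<open>Trajectory of the algorithm during exploration and after commitment\<close>

definition committed_arm :: "nat \<Rightarrow> sample \<Rightarrow> nat \<Rightarrow> nat" where
  "committed_arm m \<omega> e = (if reward_sum m \<omega> (2 * e + 1) \<le> reward_sum m \<omega> (2 * e) then 2 * e else 2 * e + 1)"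

text \<open>A one-sided passing event for two fixed arms. It replaces the data-dependent
  \<open>committed_arm\<close> when expectations are taken.\<close>

definition wins :: "nat \<Rightarrow> real \<Rightarrow> sample \<Rightarrow> nat \<Rightarrow> nat \<Rightarrow> bool" where
  "wins m \<delta> \<omega> i i' \<longleftrightarrow> \<delta> * real m \<le> reward_sum m \<omega> i - reward_sum m \<omega> i'"

definition epoch_reached :: "nat \<Rightarrow> real \<Rightarrow> sample \<Rightarrow> nat \<Rightarrow> bool" where
  "epoch_reached m \<delta> \<omega> k \<longleftrightarrow> (\<forall>e<k. epoch_fails m \<delta> \<omega> e)"

text \<open>
  Here \<open>l\<close> is the number of plays made since the start of epoch \<open>e\<close>: its arms are queried at \<open>l = 0\<close>
  and \<open>l = 1\<close>, the first one is replayed for \<open>2 \<le> l \<le> m\<close> and the second one for \<open>m < l < 2 * m\<close>.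
\<close>

definition explore_arm :: "nat \<Rightarrow> nat \<Rightarrow> nat \<Rightarrow> nat" where
  "explore_arm m e l = (if l = 1 \<or> m < l then 2 * e + 1 else 2 * e)"

text \<open>Counts before the play at offset \<open>l\<close>. Truncated subtraction keeps the
  second arm at one pull until \<open>l = m + 1\<close>; the opening queries, \<open>l < 2\<close>,
  do not follow the general formula.\<close>

definition explore_pulls :: "nat \<Rightarrow> nat \<Rightarrow> nat \<Rightarrow> nat \<Rightarrow> nat" where
  "explore_pulls m e l i =
     (if i < 2 * e then m
      else if i = 2 * e then (if l < 2 then l else min (l - 1) m)
      else if i = 2 * e + 1 then (if l < 2 then 0 else 1 + (l - (m + 1)))
      else 0)"

context
  fixes n :: nat and \<delta> :: real and \<omega> :: sample and m :: nat and h :: "nat \<Rightarrow> history"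
  defines "m \<equiv> epoch_pulls n \<delta>"
    and "h \<equiv> history (alg1 n \<delta>) \<omega>"
  assumes m_pos: "0 < m" and delta_pos: "0 < \<delta>"
begin

lemma alg1_decision:
  assumes "queries (h t) = 2 * e + 2" "m \<le> pulls (h t) (2 * e)" "m \<le> pulls (h t) (2 * e + 1)"
  shows "alg1 n \<delta> (h t) = (if epoch_fails m \<delta> \<omega> e then Query
     else Replay (if reward_sum m \<omega> (2 * e + 1) \<le> reward_sum m \<omega> (2 * e) then 2 * e else 2 * e + 1))"
proof -
  have "sum_list (take m (observed (h t) i)) = reward_sum m \<omega> i" if "m \<le> pulls (h t) i" for i
    using that unfolding h_def by (rule sum_list_take_observed)
  with assms show ?thesis
    by (simp add: alg1_def Let_def epoch_fails_def flip: m_def)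
qed

lemma explore_step:
  assumes q: "queries (h t) = 2 * e + min l 2" and p: "\<And>i. pulls (h t) i = explore_pulls m e l i"
    and l: "l < 2 * m" and fails: "\<And>e'. e' < e \<Longrightarrow> epoch_fails m \<delta> \<omega> e'"
  shows "played (alg1 n \<delta>) \<omega> t = explore_arm m e l"
    and "alg1 n \<delta> (h t) = Query \<longleftrightarrow> l < 2"
proof -
  have "alg1 n \<delta> (h t) = (if l < 2 then Query else Replay (explore_arm m e l))"
  proof (cases "l = 0")
    case True
    show ?thesis
    proof (cases e)
      case 0
      with q True show ?thesis by (simp add: alg1_def)
    next
      \<comment> \<open>The first query of an epoch is the discarding decision of the preceding
        one.\<close>
      case (Suc e')
      have "alg1 n \<delta> (h t) = (if epoch_fails m \<delta> \<omega> e' then Query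
         else Replay (if reward_sum m \<omega> (2 * e' + 1) \<le> reward_sum m \<omega> (2 * e') then 2 * e' else 2 * e' + 1))"
        using q p Suc True by (intro alg1_decision) (simp_all add: explore_pulls_def)
      then show ?thesis using fails[of e'] Suc True by simp
    qed
  next
    case False
    show ?thesis
    proof (cases "l = 1")
      case True
      with q have "odd (queries (h t))" by simp
      with True show ?thesis by (simp add: alg1_def Let_def)
    next
      case l1: False
      with \<open>l \<noteq> 0\<close> have l2: "2 \<le> l" by simp
      with q have q': "queries (h t) = 2 * e + 2" by simp
      have "pulls (h t) (2 * e) = min (l - 1) m" "pulls (h t) (2 * e + 1) = 1 + (l - (m + 1))"
        using p l2 by (simp_all add: explore_pulls_def)
      moreover have "1 + (l - (m + 1)) < m" if "m < l"
        using that l by arith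
      ultimately show ?thesis using q' l l2
        by (cases "m < l") (simp_all add: alg1_def Let_def explore_arm_def flip: m_def)
    qed
  qed
  then show "played (alg1 n \<delta>) \<omega> t = explore_arm m e l" "alg1 n \<delta> (h t) = Query \<longleftrightarrow> l < 2"
    using q by (auto simp: played_def explore_arm_def h_def[symmetric] min_def)
qed

lemma explore_state:
  assumes "\<And>e'. e' < e \<Longrightarrow> epoch_fails m \<delta> \<omega> e'" "l \<le> 2 * m"
  shows "queries (h (2 * m * e + l)) = 2 * e + min l 2 \<and>
    (\<forall>i. pulls (h (2 * m * e + l)) i = explore_pulls m e l i)"
  using assms
proof (induction e arbitrary: l)
  case 0
  from \<open>l \<le> 2 * m\<close> show ?case
  proof (induction l)
    case 0
    then show ?case by (simp add: h_def explore_pulls_def)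
  next
    case (Suc l)
    then have IH: "queries (h l) = 2 * 0 + min l 2" "\<And>i. pulls (h l) i = explore_pulls m 0 l i"
      and l: "l < 2 * m" by auto
    from explore_step[OF IH l] IH l m_pos show ?case
      by (auto simp: h_def pulls_history_Suc queries_history_Suc explore_arm_def explore_pulls_def min_def)
  qed
next
  case (Suc e)
  note fails = Suc.prems(1)
  have start: "queries (h (2 * m * Suc e)) = 2 * Suc e"
    "pulls (h (2 * m * Suc e)) i = explore_pulls m (Suc e) 0 i" for i
    using Suc.IH[of "2 * m"] Suc.prems m_pos by (auto simp: explore_pulls_def algebra_simps)
  from \<open>l \<le> 2 * m\<close> show ?case
  proof (induction l)
    case 0
    then show ?case using start by (simp add: h_def)
  next
    case (Suc l)
    then have IH: "queries (h (2 * m * Suc e + l)) = 2 * Suc e + min l 2"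
      "\<And>i. pulls (h (2 * m * Suc e + l)) i = explore_pulls m (Suc e) l i"
      and l: "l < 2 * m" by auto
    from explore_step[OF IH l fails] IH l m_pos show ?case
      by (auto simp: h_def pulls_history_Suc queries_history_Suc explore_arm_def explore_pulls_def min_def)
  qed
qed

lemma commit_state:
  assumes fails: "\<And>e'. e' < e \<Longrightarrow> epoch_fails m \<delta> \<omega> e'" and pass: "\<not> epoch_fails m \<delta> \<omega> e"
  shows "queries (h (2 * m * Suc e + s)) = 2 * e + 2 \<and>
    (\<forall>i\<in>{2 * e, 2 * e + 1}. pulls (h (2 * m * Suc e + s)) i = m + (if i = committed_arm m \<omega> e then s else 0))"
proof (induction s)
  case 0
  then show ?case using explore_state[OF fails, of e "2 * m"] m_pos
    by (auto simp: explore_pulls_def algebra_simps)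
next
  case (Suc s)
  then have "alg1 n \<delta> (h (2 * m * Suc e + s)) = Replay (committed_arm m \<omega> e)"
    using pass by (subst alg1_decision) (auto simp: committed_arm_def)
  with Suc show ?case
    by (auto simp: h_def pulls_history_Suc queries_history_Suc played_def)
qed

lemma commit_play:
  assumes fails: "\<And>e'. e' < e \<Longrightarrow> epoch_fails m \<delta> \<omega> e'" and pass: "\<not> epoch_fails m \<delta> \<omega> e"
  shows "played (alg1 n \<delta>) \<omega> (2 * m * Suc e + s) = committed_arm m \<omega> e"
    and "pulls (h (2 * m * Suc e + s)) (committed_arm m \<omega> e) = m + s"
proof -
  note st = commit_state[OF fails pass, of s]
  have "alg1 n \<delta> (h (2 * m * Suc e + s)) = Replay (committed_arm m \<omega> e)"
    using pass st by (subst alg1_decision) (auto simp: committed_arm_def)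
  then show "played (alg1 n \<delta>) \<omega> (2 * m * Suc e + s) = committed_arm m \<omega> e"
    by (simp add: played_def h_def)
  show "pulls (h (2 * m * Suc e + s)) (committed_arm m \<omega> e) = m + s"
    using st by (auto simp: committed_arm_def)
qed

lemma commit_term:
  assumes "\<not> epoch_fails m \<delta> \<omega> e"
  shows "f (committed_arm m \<omega> e) = of_bool (wins m \<delta> \<omega> (2 * e) (2 * e + 1)) * f (2 * e)
     + of_bool (wins m \<delta> \<omega> (2 * e + 1) (2 * e)) * (f (2 * e + 1) :: real)"
proof -
  have "0 < \<delta> * real m" using m_pos delta_pos by simp
  with assms show ?thesis
    by (auto simp: wins_def committed_arm_def epoch_fails_def)
qed

text \<open>Rewrites a randomly chosen play as a sum over deterministic arms and pull indices,
  weighted by indicators. This works because a commitment in epoch \<open>e\<close> starts at the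
  fixed time \<open>2 * m * Suc e\<close> with \<open>m\<close> pulls of the chosen arm.
  Expectations can then be taken term by term.\<close>

lemma regret_term:
  fixes M :: real
  assumes l: "l < 2 * m" and t: "t = 2 * m * k + l"
  shows "M - reward \<omega> (played (alg1 n \<delta>) \<omega> t) (Suc (pulls (h t) (played (alg1 n \<delta>) \<omega> t))) =
    of_bool (epoch_reached m \<delta> \<omega> k) *
      (M - reward \<omega> (explore_arm m k l) (Suc (explore_pulls m k l (explore_arm m k l)))) +
    (\<Sum>e<k. of_bool (epoch_reached m \<delta> \<omega> e) *
      (of_bool (wins m \<delta> \<omega> (2 * e) (2 * e + 1)) * (M - reward \<omega> (2 * e) (Suc (m + (t - 2 * m * Suc e)))) +
       of_bool (wins m \<delta> \<omega> (2 * e + 1) (2 * e)) * (M - reward \<omega> (2 * e + 1) (Suc (m + (t - 2 * m * Suc e))))))"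
    (is "?L = ?A + (\<Sum>e<k. ?B e)")
proof (cases "epoch_reached m \<delta> \<omega> k")
  case True
  then have fails: "epoch_fails m \<delta> \<omega> e" if "e < k" for e
    using that by (auto simp: epoch_reached_def)
  then have "?B e = 0" if "e < k" for e
    using fails[OF that] by (auto simp: wins_def epoch_fails_def)
  moreover have "queries (h t) = 2 * k + min l 2" "pulls (h t) i = explore_pulls m k l i" for i
    using explore_state[OF fails, of k l] l by (auto simp: t)
  from explore_step(1)[OF this l fails] this have "?L = ?A"
    using True by simp
  ultimately show ?thesis by simp
next
  case False
  define e where "e = (LEAST e. \<not> epoch_fails m \<delta> \<omega> e)"
  from False obtain e0 where e0: "e0 < k" "\<not> epoch_fails m \<delta> \<omega> e0"
    by (auto simp: epoch_reached_def)
  have pass: "\<not> epoch_fails m \<delta> \<omega> e"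
    unfolding e_def using e0(2) by (rule LeastI)
  have fails: "epoch_fails m \<delta> \<omega> e'" if "e' < e" for e'
    using not_less_Least[OF that[unfolded e_def]] by simp
  have "e < k"
    using Least_le[of "\<lambda>e. \<not> epoch_fails m \<delta> \<omega> e", OF e0(2)] e0(1) by (simp add: e_def)
  \<comment> \<open>Epochs before the first passing one have no winner, and those after it are not
    reached.\<close>
  have "?B e' = 0" if "e' \<noteq> e" for e'
  proof (cases "e' < e")
    case True
    then show ?thesis using fails[OF True] by (auto simp: wins_def epoch_fails_def)
  next
    case False
    with that have "e < e'" by simp
    then have "\<not> epoch_reached m \<delta> \<omega> e'"
      using pass by (auto simp: epoch_reached_def)
    then show ?thesis by simp
  qed
  then have "(\<Sum>e<k. ?B e) = ?B e"
    using \<open>e < k\<close> by (subst sum.remove[of _ e]) auto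
  also have "\<dots> = M - reward \<omega> (committed_arm m \<omega> e) (Suc (m + (t - 2 * m * Suc e)))"
    using commit_term[OF pass, of "\<lambda>i. M - reward \<omega> i (Suc (m + (t - 2 * m * Suc e)))"] fails
    by (simp add: epoch_reached_def)
  also have "\<dots> = ?L"
  proof -
    have "2 * m * Suc e \<le> 2 * m * k"
      using \<open>e < k\<close> by (intro mult_le_mono2) simp
    then have "2 * m * Suc e + (t - 2 * m * Suc e) = t"
      using t by linarith
    with commit_play[OF fails pass, of "t - 2 * m * Suc e"] show ?thesis by simp
  qed
  finally show ?thesis using False by simp
qed

end

section \<open>Independent coordinates of the bandit\<close>

text \<open>
  \<open>T i\<close> carries the type of arm \<open>i\<close> (the value 1 stands for \<open>Optimal\<close>), and \<open>X i k j\<close> the \<open>j\<close>-th reward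
  that arm \<open>i\<close> yields if it has type \<open>k\<close>. Types and these potential rewards are all independent.
\<close>

datatype coord = T nat | X nat arm_type nat

fun arm_of :: "coord \<Rightarrow> nat" where
  "arm_of (T i) = i"
| "arm_of (X i k j) = i"

fun coord_law :: "(nat \<Rightarrow> real) \<Rightarrow> (nat \<Rightarrow> arm_type \<Rightarrow> nat \<Rightarrow> real measure) \<Rightarrow> coord \<Rightarrow> real measure" where
  "coord_law g \<nu> (T i) = distr (measure_pmf (bernoulli_pmf (g i))) borel of_bool"
| "coord_law g \<nu> (X i k j) = \<nu> i k j"

definition type_of :: "(coord \<Rightarrow> real) \<Rightarrow> nat \<Rightarrow> arm_type" where
  "type_of \<omega> i = (if \<omega> (T i) = 1 then Optimal else Inferior)"

definition sample_of :: "(coord \<Rightarrow> real) \<Rightarrow> sample" where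
  "sample_of \<omega> i = (type_of \<omega> i, \<lambda>j. \<omega> (X i (type_of \<omega> i) j))"

abbreviation "arm_space \<equiv> count_space (UNIV :: arm_type set) \<Otimes>\<^sub>M Pi\<^sub>M (UNIV :: nat set) (\<lambda>_. borel :: real measure)"

text \<open>A functional substitute for measurability with respect to the sigma-algebra generated by
  the coordinates in \<open>A\<close>.\<close>

definition depends_on :: "((coord \<Rightarrow> real) \<Rightarrow> 'a) \<Rightarrow> coord set \<Rightarrow> bool" where
  "depends_on f A \<longleftrightarrow> (\<forall>\<omega> \<omega>'. (\<forall>x\<in>A. \<omega> x = \<omega>' x) \<longrightarrow> f \<omega> = f \<omega>')"

locale coordinates =
  fixes \<mu> :: "arm_type \<Rightarrow> real" and g :: "nat \<Rightarrow> real"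
    and \<nu> :: "nat \<Rightarrow> arm_type \<Rightarrow> nat \<Rightarrow> real measure"
  assumes laws: "reward_laws \<mu> \<nu>" and g01: "\<And>i. 0 \<le> g i" "\<And>i. g i \<le> 1"
begin

definition \<Omega> :: "(coord \<Rightarrow> real) measure" where
  "\<Omega> = Pi\<^sub>M UNIV (coord_law g \<nu>)"

lemma prob_space_law: "prob_space (\<nu> i k j)" and sets_law [measurable_cong]: "sets (\<nu> i k j) = sets borel"
  and AE_law: "AE x in \<nu> i k j. x \<in> {0..1}" and mean_law: "(\<integral>x. x \<partial>\<nu> i k j) = \<mu> k"
  using laws by (auto simp: reward_laws_def)

lemma prob_space_coord_law: "prob_space (coord_law g \<nu> x)"
  by (cases x) (auto intro: prob_space_law prob_space.prob_space_distr[OF prob_space_measure_pmf])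

lemma sets_coord_law: "sets (coord_law g \<nu> x) = sets borel"
  by (cases x) (auto simp: sets_law)

sublocale prob_space \<Omega>
  unfolding \<Omega>_def by (intro prob_space_PiM prob_space_coord_law)

lemma sets_Omega [measurable_cong]: "sets \<Omega> = sets (Pi\<^sub>M UNIV (\<lambda>_. borel))"
  unfolding \<Omega>_def by (intro sets_PiM_cong refl sets_coord_law)

lemma space_Omega [simp]: "space \<Omega> = UNIV"
  using sets_eq_imp_space_eq[OF sets_Omega] by (simp add: space_PiM)

lemma distr_coord: "distr \<Omega> borel (\<lambda>\<omega>. \<omega> x) = coord_law g \<nu> x"
proof -
  have "distr \<Omega> borel (\<lambda>\<omega>. \<omega> x) = distr \<Omega> (coord_law g \<nu> x) (\<lambda>\<omega>. \<omega> x)"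
    by (intro distr_cong) (auto simp: sets_coord_law)
  also have "\<dots> = coord_law g \<nu> x"
    unfolding \<Omega>_def by (intro distr_PiM_component prob_space_coord_law) auto
  finally show ?thesis .
qed

lemma indep_coords: "indep_vars (\<lambda>_. borel) (\<lambda>x \<omega>. \<omega> x) UNIV"
proof -
  have "distr \<Omega> (Pi\<^sub>M UNIV (\<lambda>_. borel)) (\<lambda>\<omega>. \<lambda>x\<in>UNIV. \<omega> x) = \<Omega>"
    using distr_id2[OF sets_Omega[symmetric]] by (simp add: id_def restrict_UNIV)
  also have "\<Omega> = (\<Pi>\<^sub>M x\<in>UNIV. distr \<Omega> borel (\<lambda>\<omega>. \<omega> x))"
    by (subst distr_coord) (simp add: \<Omega>_def)
  finally show ?thesis
    by (subst indep_vars_iff_distr_eq_PiM) auto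
qed

lemma measurable_extend_zero:
  "(\<lambda>\<xi> x. if x \<in> A then \<xi> x else 0) \<in> measurable (Pi\<^sub>M A (\<lambda>_. borel)) \<Omega>"
proof (subst measurable_cong_sets[OF refl sets_Omega], rule measurable_PiM_single')
  show "(\<lambda>\<xi>. if x \<in> A then \<xi> x else 0) \<in> borel_measurable (Pi\<^sub>M A (\<lambda>_. borel))" for x
    by (cases "x \<in> A") auto
qed auto

text \<open>A function of the coordinates in \<open>A\<close> does not change when all others are
  set to 0, so it factors measurably through the restriction to \<open>A\<close>, and restrictions
  to disjoint blocks are independent.\<close>

lemma block_indep:
  fixes f h :: "(coord \<Rightarrow> real) \<Rightarrow> real"
  assumes m: "f \<in> borel_measurable \<Omega>" "h \<in> borel_measurable \<Omega>"
    and d: "depends_on f A" "depends_on h B" and AB: "A \<inter> B = {}"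
  shows "indep_var borel f borel h"
proof -
  define ext where "ext A \<xi> = (\<lambda>x. if x \<in> A then \<xi> x else (0::real))" for A :: "coord set" and \<xi>
  have ext: "ext A \<in> measurable (Pi\<^sub>M A (\<lambda>_. borel)) \<Omega>" for A
    unfolding ext_def by (rule measurable_extend_zero)
  have "indep_var borel ((f \<circ> ext A) \<circ> (\<lambda>\<omega>. restrict (\<lambda>x. \<omega> x) A)) borel ((h \<circ> ext B) \<circ> (\<lambda>\<omega>. restrict (\<lambda>x. \<omega> x) B))"
    using AB by (intro indep_var_compose[OF indep_var_restrict[OF indep_coords]] measurable_comp[OF ext] m) auto
  moreover have "(f \<circ> ext A) \<circ> (\<lambda>\<omega>. restrict (\<lambda>x. \<omega> x) A) = f"
    using d(1) unfolding depends_on_def by (auto simp: fun_eq_iff ext_def)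
  moreover have "(h \<circ> ext B) \<circ> (\<lambda>\<omega>. restrict (\<lambda>x. \<omega> x) B) = h"
    using d(2) unfolding depends_on_def by (auto simp: fun_eq_iff ext_def)
  ultimately show ?thesis by simp
qed

lemma block_expectation:
  fixes f h :: "(coord \<Rightarrow> real) \<Rightarrow> real"
  assumes "integrable \<Omega> f" "integrable \<Omega> h" "depends_on f A" "depends_on h B" "A \<inter> B = {}"
  shows "expectation (\<lambda>\<omega>. f \<omega> * h \<omega>) = expectation f * expectation h"
    and "integrable \<Omega> (\<lambda>\<omega>. f \<omega> * h \<omega>)"
proof -
  have ind: "indep_var borel f borel h"
    using assms by (intro block_indep[of f h A B]) auto
  show "expectation (\<lambda>\<omega>. f \<omega> * h \<omega>) = expectation f * expectation h"
    "integrable \<Omega> (\<lambda>\<omega>. f \<omega> * h \<omega>)"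
    using indep_var_lebesgue_integral[OF ind] indep_var_integrable[OF ind] assms by auto
qed

lemma measurable_type_of [measurable]: "(\<lambda>\<omega>. type_of \<omega> i) \<in> measurable \<Omega> (count_space UNIV)"
  unfolding type_of_def by measurable

lemma sets_type_eq_one [measurable]: "{\<omega>. \<omega> (T i) = 1} \<in> sets \<Omega>"
proof -
  have "{\<omega> \<in> space \<Omega>. \<omega> (T i) = 1} \<in> sets \<Omega>" by measurable
  then show ?thesis by simp
qed

lemma prob_type_of: "prob {\<omega>. type_of \<omega> i = k} = (if k = Optimal then g i else 1 - g i)"
proof -
  have "prob {\<omega>. \<omega> (T i) = 1} = measure (distr \<Omega> borel (\<lambda>\<omega>. \<omega> (T i))) {1}"
    by (subst measure_distr) (auto simp: vimage_def)
  also have "\<dots> = measure (measure_pmf (bernoulli_pmf (g i))) {True}"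
    by (subst distr_coord) (auto simp: measure_distr vimage_def intro!: arg_cong2[where f = measure])
  also have "\<dots> = g i" using g01[of i] by (simp add: measure_pmf_single)
  finally have opt: "prob {\<omega>. \<omega> (T i) = 1} = g i" .
  have "prob (space \<Omega> - {\<omega>. \<omega> (T i) = 1}) = 1 - g i"
    using opt by (subst prob_compl) auto
  moreover have "{\<omega>. type_of \<omega> i = Inferior} = space \<Omega> - {\<omega>. \<omega> (T i) = 1}"
    by (auto simp: type_of_def)
  moreover have "{\<omega>. type_of \<omega> i = Optimal} = {\<omega>. \<omega> (T i) = 1}"
    by (auto simp: type_of_def)
  ultimately show ?thesis using opt by (cases k) auto
qed

lemma measurable_sample_of_arm [measurable]: "(\<lambda>\<omega>. sample_of \<omega> i) \<in> measurable \<Omega> arm_space"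
proof -
  have *: "(\<lambda>\<omega>. sample_of \<omega> i) =
     (\<lambda>\<omega>. (type_of \<omega> i, if \<omega> (T i) = 1 then (\<lambda>j. \<omega> (X i Optimal j)) else (\<lambda>j. \<omega> (X i Inferior j))))"
    by (auto simp: sample_of_def type_of_def fun_eq_iff)
  have [measurable]: "(\<lambda>\<omega> j. \<omega> (X i k j)) \<in> measurable \<Omega> (Pi\<^sub>M UNIV (\<lambda>_. borel))" for k
    by (rule measurable_PiM_single') auto
  have "(\<lambda>\<omega>. if \<omega> (T i) = 1 then (\<lambda>j. \<omega> (X i Optimal j)) else (\<lambda>j. \<omega> (X i Inferior j)))
      \<in> measurable \<Omega> (Pi\<^sub>M UNIV (\<lambda>_. borel))"
    by (rule measurable_If) auto
  then show ?thesis unfolding * by measurable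
qed

lemma kernel_measurable:
  "(\<lambda>k. distr (Pi\<^sub>M UNIV (\<nu> i k)) arm_space (Pair k)) \<in> measurable (measure_pmf q) (subprob_algebra arm_space)"
  "Pair k \<in> measurable (Pi\<^sub>M UNIV (\<nu> i k)) arm_space"
proof -
  have s: "sets (Pi\<^sub>M UNIV (\<nu> i k)) = sets (Pi\<^sub>M UNIV (\<lambda>_. borel))" for k
    by (intro sets_PiM_cong refl sets_law)
  show P: "Pair k \<in> measurable (Pi\<^sub>M UNIV (\<nu> i k)) arm_space" for k
    by (subst measurable_cong_sets[OF s refl]) measurable
  show "(\<lambda>k. distr (Pi\<^sub>M UNIV (\<nu> i k)) arm_space (Pair k)) \<in> measurable (measure_pmf q) (subprob_algebra arm_space)"
    by (simp add: measurable_pmf_measure1 space_subprob_algebra)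
      (auto intro!: prob_space_imp_subprob_space prob_space.prob_space_distr P prob_space_PiM prob_space_law)
qed

lemma sets_arm_law [measurable_cong]: "sets (arm_law p (\<nu> i)) = sets arm_space"
  unfolding arm_law_def by (subst sets_bind[where N = arm_space]) auto

text \<open>An independent type coordinate selects one of two potential reward sequences; the
  sequence not selected is integrated out, which leaves the mixture over types.\<close>

lemma distr_sample_of_arm: "distr \<Omega> arm_space (\<lambda>\<omega>. sample_of \<omega> i) = arm_law (g i) (\<nu> i)"
proof (rule measure_eqI)
  fix A assume "A \<in> sets (distr \<Omega> arm_space (\<lambda>\<omega>. sample_of \<omega> i))"
  then have A[measurable]: "A \<in> sets arm_space" by simp
  define R where "R k = {\<omega>. (k, \<lambda>j. \<omega> (X i k j)) \<in> A}" for k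
  have [measurable]: "(\<lambda>\<omega> j. \<omega> (X i k j)) \<in> measurable \<Omega> (Pi\<^sub>M UNIV (\<lambda>_. borel))" for k
    by (rule measurable_PiM_single') auto
  have R[measurable]: "R k \<in> sets \<Omega>" for k
  proof -
    have "{\<omega> \<in> space \<Omega>. (k, \<lambda>j. \<omega> (X i k j)) \<in> A} \<in> sets \<Omega>" by measurable
    then show ?thesis by (simp add: R_def)
  qed
  have [measurable]: "{\<omega>. type_of \<omega> i = k} \<in> sets \<Omega>" for k
  proof -
    have "{\<omega> \<in> space \<Omega>. type_of \<omega> i = k} \<in> sets \<Omega>" by measurable
    then show ?thesis by simp
  qed
  have split: "prob ({\<omega>. type_of \<omega> i = k} \<inter> R k) = prob {\<omega>. type_of \<omega> i = k} * prob (R k)" for k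
  proof -
    have "expectation (\<lambda>\<omega>. indicat_real {\<omega>. type_of \<omega> i = k} \<omega> * indicat_real (R k) \<omega>)
        = expectation (indicat_real {\<omega>. type_of \<omega> i = k}) * expectation (indicat_real (R k))"
    proof (rule block_expectation(1))
      show "depends_on (indicat_real {\<omega>. type_of \<omega> i = k}) {T i}"
        "depends_on (indicat_real (R k)) (range (X i k))"
        by (auto simp: depends_on_def type_of_def R_def indicator_def)
    qed (auto simp flip: less_top)
    then show ?thesis by (simp flip: indicator_inter_arith)
  qed
  have emR: "emeasure \<Omega> (R k) = emeasure (distr (Pi\<^sub>M UNIV (\<nu> i k)) arm_space (Pair k)) A" for k
  proof -
    have "emeasure (distr (Pi\<^sub>M UNIV (\<nu> i k)) arm_space (Pair k)) A = emeasure (Pi\<^sub>M UNIV (\<nu> i k)) (Pair k -` A)"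
      by (subst emeasure_distr[OF kernel_measurable(2) A]) (simp add: space_PiM sets_eq_imp_space_eq[OF sets_law])
    also have "\<dots> = emeasure (distr \<Omega> (Pi\<^sub>M UNIV (\<nu> i k)) (\<lambda>\<omega> j. \<omega> (X i k j))) (Pair k -` A)"
      using distr_PiM_reindex[of UNIV "coord_law g \<nu>" "X i k" UNIV] prob_space_coord_law
      by (simp add: \<Omega>_def inj_on_def restrict_UNIV)
    also have "\<dots> = emeasure \<Omega> (R k)"
    proof (subst emeasure_distr)
      show "Pair k -` A \<in> sets (Pi\<^sub>M UNIV (\<nu> i k))"
        using measurable_sets[OF kernel_measurable(2) A, of k] by (simp add: space_PiM sets_eq_imp_space_eq[OF sets_law])
      show "(\<lambda>\<omega> j. \<omega> (X i k j)) \<in> measurable \<Omega> (Pi\<^sub>M UNIV (\<nu> i k))"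
        by (rule measurable_PiM_single') (auto simp: sets_eq_imp_space_eq[OF sets_law])
    qed (simp add: R_def vimage_def)
    finally show ?thesis by simp
  qed
  have "emeasure (arm_law (g i) (\<nu> i)) A = (\<integral>\<^sup>+k. emeasure \<Omega> (R k) \<partial>measure_pmf (type_pmf (g i)))"
    unfolding arm_law_def emR by (subst emeasure_bind[OF _ kernel_measurable(1) A]) auto
  also have "\<dots> = emeasure \<Omega> (R Optimal) * ennreal (g i) + emeasure \<Omega> (R Inferior) * ennreal (1 - g i)"
    using g01[of i] by (simp add: type_pmf_def)
  also have "\<dots> = ennreal (prob {\<omega>. type_of \<omega> i = Optimal} * prob (R Optimal)
      + prob {\<omega>. type_of \<omega> i = Inferior} * prob (R Inferior))"
    using g01[of i] by (subst ennreal_plus) (auto simp: prob_type_of emeasure_eq_measure ennreal_mult mult.commute)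
  also have "\<dots> = ennreal (prob (({\<omega>. type_of \<omega> i = Optimal} \<inter> R Optimal) \<union> ({\<omega>. type_of \<omega> i = Inferior} \<inter> R Inferior)))"
    unfolding split[symmetric] by (subst finite_measure_Union) auto
  also have "({\<omega>. type_of \<omega> i = Optimal} \<inter> R Optimal) \<union> ({\<omega>. type_of \<omega> i = Inferior} \<inter> R Inferior)
      = (\<lambda>\<omega>. sample_of \<omega> i) -` A \<inter> space \<Omega>"
    by (auto simp: sample_of_def R_def type_of_def split: if_splits)
  finally show "emeasure (distr \<Omega> arm_space (\<lambda>\<omega>. sample_of \<omega> i)) A = emeasure (arm_law (g i) (\<nu> i)) A"
    by (simp add: emeasure_distr emeasure_eq_measure)
qed (simp add: sets_arm_law)

lemma sets_bandit [measurable_cong]: "sets (bandit g \<nu>) = sets (Pi\<^sub>M UNIV (\<lambda>_. arm_space))"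
  unfolding bandit_def by (intro sets_PiM_cong refl sets_arm_law)

lemma measurable_sample_of [measurable]: "sample_of \<in> measurable \<Omega> (bandit g \<nu>)"
proof (subst measurable_cong_sets[OF refl sets_bandit], rule measurable_PiM_single')
qed (auto simp: space_pair_measure space_PiM)

text \<open>Different arms read disjoint blocks of coordinates, so the joint law is the product of
  the marginals. This carries expectations over from the bandit, where type and rewards of an arm
  are dependent, to a space where everything is independent.\<close>

lemma bandit_eq_distr: "bandit g \<nu> = distr \<Omega> (bandit g \<nu>) sample_of"
proof -
  define K where "K i = {x. arm_of x = i}" for i
  define \<phi> where "\<phi> = (\<lambda>i \<xi>. sample_of (\<lambda>x. if x \<in> K i then \<xi> x else 0) i)"
  have phi: "\<phi> i \<in> measurable (Pi\<^sub>M (K i) (\<lambda>_. borel)) arm_space" for i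
  proof -
    from measurable_compose[OF measurable_extend_zero measurable_sample_of_arm] show ?thesis by (simp add: \<phi>_def)
  qed
  have "indep_vars (\<lambda>i. Pi\<^sub>M (K i) (\<lambda>_. borel)) (\<lambda>i \<omega>. restrict (\<lambda>x. \<omega> x) (K i)) UNIV"
    by (rule indep_vars_restrict[OF indep_coords]) (auto simp: disjoint_family_on_def K_def)
  from indep_vars_compose2[OF this phi]
  have "indep_vars (\<lambda>_. arm_space) (\<lambda>i \<omega>. \<phi> i (restrict (\<lambda>x. \<omega> x) (K i))) UNIV" .
  also have "(\<lambda>i \<omega>. \<phi> i (restrict (\<lambda>x. \<omega> x) (K i))) = (\<lambda>i \<omega>. sample_of \<omega> i)"
    by (auto simp: \<phi>_def fun_eq_iff sample_of_def type_of_def K_def)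
  finally have "distr \<Omega> (Pi\<^sub>M UNIV (\<lambda>_. arm_space)) (\<lambda>\<omega>. \<lambda>i\<in>UNIV. sample_of \<omega> i)
      = (\<Pi>\<^sub>M i\<in>UNIV. distr \<Omega> arm_space (\<lambda>\<omega>. sample_of \<omega> i))"
    by (subst (asm) indep_vars_iff_distr_eq_PiM) auto
  also have "\<dots> = bandit g \<nu>" by (simp add: distr_sample_of_arm bandit_def)
  also have "distr \<Omega> (Pi\<^sub>M UNIV (\<lambda>_. arm_space)) (\<lambda>\<omega>. \<lambda>i\<in>UNIV. sample_of \<omega> i) = distr \<Omega> (bandit g \<nu>) sample_of"
    by (intro distr_cong) (auto simp: sets_bandit)
  finally show ?thesis by simp
qed

end

section \<open>Conditioning on types and deviations of the test statistic\<close>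

lemma UNIV_arm_type: "(UNIV :: arm_type set) = {Optimal, Inferior}"
  using arm_type.exhaust by auto

context coordinates
begin

lemma AE_coord: "AE \<omega> in \<Omega>. \<omega> (X i k j) \<in> {0..1}"
proof -
  have "AE x in coord_law g \<nu> (X i k j). x \<in> {0..1}"
    unfolding coord_law.simps by (rule AE_law)
  then show ?thesis
    unfolding \<Omega>_def by (intro AE_PiM_component[where P = "\<lambda>x. x \<in> {0..1}"] prob_space_coord_law) auto
qed

lemma integrable_coord [simp]: "integrable \<Omega> (\<lambda>\<omega>. \<omega> (X i k j))"
  by (rule integrable_const_bound[where B = 1]) (use AE_coord[of i k j] in \<open>auto elim: eventually_mono\<close>)

lemma integral_coord:
  fixes f :: "real \<Rightarrow> real"
  assumes "f \<in> borel_measurable borel"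
  shows "expectation (\<lambda>\<omega>. f (\<omega> (X i k j))) = (\<integral>x. f x \<partial>\<nu> i k j)"
proof -
  have "(\<integral>x. f x \<partial>\<nu> i k j) = (\<integral>x. f x \<partial>distr \<Omega> borel (\<lambda>\<omega>. \<omega> (X i k j)))"
    by (simp add: distr_coord)
  then show ?thesis using assms by (simp add: integral_distr)
qed

lemma expectation_coord [simp]: "expectation (\<lambda>\<omega>. \<omega> (X i k j)) = \<mu> k"
  using integral_coord[of "\<lambda>x. x"] mean_law by simp

lemma mean_in_unit: "0 \<le> \<mu> k" "\<mu> k \<le> 1"
proof -
  have *: "AE \<omega> in \<Omega>. 0 \<le> \<omega> (X 0 k 0)" "AE \<omega> in \<Omega>. \<omega> (X 0 k 0) \<le> 1"
    using AE_coord[of 0 k 0] by (auto elim: eventually_mono)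
  show "0 \<le> \<mu> k" using integral_nonneg_AE[OF *(1)] by simp
  show "\<mu> k \<le> 1" using integral_mono_AE[OF integrable_coord _ *(2)] by (simp add: prob_space[unfolded space_Omega])
qed

lemma integrable_of_bool_mult:
  fixes f :: "(coord \<Rightarrow> real) \<Rightarrow> real"
  assumes "Measurable.pred \<Omega> P" "integrable \<Omega> f"
  shows "integrable \<Omega> (\<lambda>\<omega>. of_bool (P \<omega>) * f \<omega>)"
proof -
  have "integrable \<Omega> (\<lambda>\<omega>. f \<omega> * indicator {\<omega> \<in> space \<Omega>. P \<omega>} \<omega>)"
    using assms by (intro integrable_real_mult_indicator) (auto simp: pred_def)
  moreover have "indicator {\<omega> \<in> space \<Omega>. P \<omega>} \<omega> = (of_bool (P \<omega>) :: real)" for \<omega>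
    by (simp add: indicator_def)
  ultimately show ?thesis by (simp add: mult.commute)
qed

lemma expectation_of_bool:
  assumes "Measurable.pred \<Omega> P"
  shows "expectation (\<lambda>\<omega>. of_bool (P \<omega>)) = prob {\<omega>. P \<omega>}"
    and "integrable \<Omega> (\<lambda>\<omega>. of_bool (P \<omega>) :: real)"
proof -
  have "{\<omega>. P \<omega>} \<in> sets \<Omega>" using assms by (simp add: pred_def)
  moreover have "indicator {\<omega>. P \<omega>} = (\<lambda>\<omega>. of_bool (P \<omega>) :: real)"
    by (auto simp: indicator_def)
  ultimately show "expectation (\<lambda>\<omega>. of_bool (P \<omega>)) = prob {\<omega>. P \<omega>}"
    by (metis Bochner_Integration.integral_indicator measure_space_inter Int_UNIV_right space_Omega)
  show "integrable \<Omega> (\<lambda>\<omega>. of_bool (P \<omega>) :: real)"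
    using integrable_of_bool_mult[OF assms, of "\<lambda>_. 1"] by simp
qed

text \<open>Once the two types are fixed, \<open>h\<close> involves potential rewards only, and
  these are independent of the type coordinates.\<close>

lemma expectation_types:
  fixes h :: "arm_type \<Rightarrow> arm_type \<Rightarrow> (coord \<Rightarrow> real) \<Rightarrow> real"
  assumes i: "i \<noteq> i'" and int: "\<And>k k'. integrable \<Omega> (h k k')"
    and dep: "\<And>k k'. depends_on (h k k') {x. \<exists>i k j. x = X i k j}"
  shows "expectation (\<lambda>\<omega>. h (type_of \<omega> i) (type_of \<omega> i') \<omega>) =
    (\<Sum>k\<in>UNIV. \<Sum>k'\<in>UNIV. prob {\<omega>. type_of \<omega> i = k} * prob {\<omega>. type_of \<omega> i' = k'} * expectation (h k k'))"
    and "integrable \<Omega> (\<lambda>\<omega>. h (type_of \<omega> i) (type_of \<omega> i') \<omega>)"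
proof -
  define b where "b i k \<omega> = (of_bool (type_of \<omega> i = k) :: real)" for i k \<omega>
  have b: "expectation (b i k) = prob {\<omega>. type_of \<omega> i = k}" "integrable \<Omega> (b i k)" for i k
    unfolding b_def[abs_def] by (intro expectation_of_bool, measurable)+
  have db: "depends_on (b i k) {T i}" for i k
    by (auto simp: depends_on_def b_def type_of_def)
  have bb: "expectation (\<lambda>\<omega>. b i k \<omega> * b i' k' \<omega>) = expectation (b i k) * expectation (b i' k')"
    "integrable \<Omega> (\<lambda>\<omega>. b i k \<omega> * b i' k' \<omega>)" for k k'
    by (rule block_expectation[OF b(2) b(2) db db]; use i in simp)+
  have dbb: "depends_on (\<lambda>\<omega>. b i k \<omega> * b i' k' \<omega>) {T i, T i'}" for k k'
    by (auto simp: depends_on_def b_def type_of_def)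
  have bbh: "expectation (\<lambda>\<omega>. b i k \<omega> * b i' k' \<omega> * h k k' \<omega>) =
      prob {\<omega>. type_of \<omega> i = k} * prob {\<omega>. type_of \<omega> i' = k'} * expectation (h k k')"
    "integrable \<Omega> (\<lambda>\<omega>. b i k \<omega> * b i' k' \<omega> * h k k' \<omega>)" for k k'
    using block_expectation[OF bb(2) int dbb dep] bb(1) b(1) by auto
  have *: "h (type_of \<omega> i) (type_of \<omega> i') \<omega> = (\<Sum>k\<in>UNIV. \<Sum>k'\<in>UNIV. b i k \<omega> * b i' k' \<omega> * h k k' \<omega>)" for \<omega>
    by (cases "type_of \<omega> i"; cases "type_of \<omega> i'") (simp_all add: UNIV_arm_type b_def)
  show "expectation (\<lambda>\<omega>. h (type_of \<omega> i) (type_of \<omega> i') \<omega>) =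
    (\<Sum>k\<in>UNIV. \<Sum>k'\<in>UNIV. prob {\<omega>. type_of \<omega> i = k} * prob {\<omega>. type_of \<omega> i' = k'} * expectation (h k k'))"
    unfolding * using bbh by (simp add: UNIV_arm_type)
  show "integrable \<Omega> (\<lambda>\<omega>. h (type_of \<omega> i) (type_of \<omega> i') \<omega>)"
    unfolding * using bbh by simp
qed

definition reward_diff :: "nat \<Rightarrow> nat \<Rightarrow> arm_type \<Rightarrow> nat \<Rightarrow> arm_type \<Rightarrow> (coord \<Rightarrow> real) \<Rightarrow> real" where
  "reward_diff m i k i' k' \<omega> = (\<Sum>j = 1..m. \<omega> (X i k j)) - (\<Sum>j = 1..m. \<omega> (X i' k' j))"

lemma measurable_reward_diff [measurable]: "reward_diff m i k i' k' \<in> borel_measurable \<Omega>"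
  unfolding reward_diff_def[abs_def] by measurable

lemma reward_sum_sample_of: "reward_sum m (sample_of \<omega>) i - reward_sum m (sample_of \<omega>) i'
    = reward_diff m i (type_of \<omega> i) i' (type_of \<omega> i') \<omega>"
  by (simp add: reward_sum_def reward_diff_def reward_def sample_of_def)

definition coords :: "nat \<Rightarrow> nat \<Rightarrow> arm_type \<Rightarrow> nat \<Rightarrow> arm_type \<Rightarrow> coord set" where
  "coords m i k i' k' = X i k ` {1..m} \<union> X i' k' ` {1..m}"

lemma sum_coords:
  fixes F :: "coord \<Rightarrow> real"
  assumes "i \<noteq> i'"
  shows "sum F (coords m i k i' k') = (\<Sum>j = 1..m. F (X i k j)) + (\<Sum>j = 1..m. F (X i' k' j))"
  unfolding coords_def using assms
  by (subst sum.union_disjoint) (auto simp: sum.reindex inj_on_def)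

lemma indep_signed_coords:
  fixes s b :: "coord \<Rightarrow> real"
  shows "indep_vars (\<lambda>_. borel) (\<lambda>x \<omega>. s x * (\<omega> x - b x)) I"
  by (rule indep_vars_compose2[OF indep_vars_subset[OF indep_coords]]) auto

text \<open>The difference is a sum of \<open>2 * m\<close> independent signed rewards with ranges
  of length 1, so Hoeffding's exponent is \<open>2 * \<epsilon>^2 / (2 * m)\<close>.\<close>

lemma reward_diff_tails:
  assumes i: "i \<noteq> i'" and m: "0 < m" and \<epsilon>: "0 \<le> \<epsilon>"
  shows "prob {\<omega>. real m * (\<mu> k - \<mu> k') + \<epsilon> \<le> reward_diff m i k i' k' \<omega>} \<le> exp (- \<epsilon>\<^sup>2 / real m)"
    and "prob {\<omega>. reward_diff m i k i' k' \<omega> \<le> real m * (\<mu> k - \<mu> k') - \<epsilon>} \<le> exp (- \<epsilon>\<^sup>2 / real m)"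
proof -
  define s :: "coord \<Rightarrow> real" where "s x = (if arm_of x = i then 1 else -1)" for x
  define Y where "Y = (\<lambda>x (\<omega> :: coord \<Rightarrow> real). s x * (\<omega> x - 0))"
  let ?I = "coords m i k i' k'"
  interpret H: Hoeffding_ineq \<Omega> ?I Y "\<lambda>x. min 0 (s x)" "\<lambda>x. max 0 (s x)" "\<Sum>x\<in>?I. expectation (Y x)"
  proof unfold_locales
    show "indep_vars (\<lambda>_. borel) Y ?I"
      unfolding Y_def by (rule indep_signed_coords)
    fix x assume "x \<in> ?I"
    then obtain i k j where "x = X i k j" by (auto simp: coords_def)
    then show "AE \<omega> in \<Omega>. Y x \<omega> \<in> {min 0 (s x)..max 0 (s x)}"
      using AE_coord[of i k j] by (auto simp: Y_def s_def elim!: eventually_mono)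
  qed (auto simp: coords_def)
  have sq: "(\<Sum>x\<in>?I. (max 0 (s x) - min 0 (s x))\<^sup>2) = 2 * real m"
  proof -
    have "(max 0 (s x) - min 0 (s x))\<^sup>2 = 1" for x by (simp add: s_def)
    then show ?thesis by (subst sum_coords[OF i]) simp
  qed
  have mean: "(\<Sum>x\<in>?I. expectation (Y x)) = real m * (\<mu> k - \<mu> k')"
    using i by (simp add: sum_coords Y_def s_def algebra_simps)
  have diff: "(\<Sum>x\<in>?I. Y x \<omega>) = reward_diff m i k i' k' \<omega>" for \<omega>
    using i by (simp add: sum_coords Y_def s_def reward_diff_def sum_negf)
  show "prob {\<omega>. real m * (\<mu> k - \<mu> k') + \<epsilon> \<le> reward_diff m i k i' k' \<omega>} \<le> exp (- \<epsilon>\<^sup>2 / real m)"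
    using H.Hoeffding_ineq_ge[OF \<epsilon>] m by (simp add: sq mean diff)
  show "prob {\<omega>. reward_diff m i k i' k' \<omega> \<le> real m * (\<mu> k - \<mu> k') - \<epsilon>} \<le> exp (- \<epsilon>\<^sup>2 / real m)"
    using H.Hoeffding_ineq_le[OF \<epsilon>] m by (simp add: sq mean diff)
qed

lemma prob_reward_diff_ge_mean:
  assumes i: "i \<noteq> i'"
    and var: "7 \<le> (\<Sum>j = 1..m. reward_var \<mu> \<nu> i k j) + (\<Sum>j = 1..m. reward_var \<mu> \<nu> i' k' j)"
  shows "1 / 7 \<le> prob {\<omega>. real m * (\<mu> k - \<mu> k') \<le> reward_diff m i k i' k' \<omega>}"
proof -
  define s :: "coord \<Rightarrow> real" where "s x = (if arm_of x = i then 1 else -1)" for x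
  define b :: "coord \<Rightarrow> real" where "b x = (case x of X i k j \<Rightarrow> \<mu> k | T i \<Rightarrow> 0)" for x
  define Y where "Y = (\<lambda>x (\<omega> :: coord \<Rightarrow> real). s x * (\<omega> x - b x))"
  let ?I = "coords m i k i' k'"
  have "1 / 7 \<le> prob {\<omega> \<in> space \<Omega>. 0 \<le> (\<Sum>x\<in>?I. Y x \<omega>)}"
  proof (rule prob_indep_sum_nonneg)
    show "finite ?I" by (simp add: coords_def)
    show "indep_vars (\<lambda>_. borel) Y ?I"
      unfolding Y_def by (rule indep_signed_coords)
    show "AE \<omega> in \<Omega>. \<bar>Y x \<omega>\<bar> \<le> 1" if "x \<in> ?I" for x
    proof -
      from that obtain i k j where x: "x = X i k j" by (auto simp: coords_def)
      show ?thesis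
        using AE_coord[of i k j]
        by eventually_elim (use mean_in_unit[of k] in \<open>auto simp: Y_def s_def b_def x\<close>)
    qed
    show "expectation (Y x) = 0" if "x \<in> ?I" for x
      using that by (auto simp: coords_def Y_def b_def prob_space[unfolded space_Omega])
    have "expectation (\<lambda>\<omega>. (Y (X i k j) \<omega>)\<^sup>2) = reward_var \<mu> \<nu> i k j" for i k j
      using integral_coord[of "\<lambda>x. (x - \<mu> k)\<^sup>2" i k j] by (simp add: Y_def s_def b_def reward_var_def power_mult_distrib)
    then show "7 \<le> (\<Sum>x\<in>?I. expectation (\<lambda>\<omega>. (Y x \<omega>)\<^sup>2))"
      using var i by (simp add: sum_coords)
  qed
  moreover have "(\<Sum>x\<in>?I. Y x \<omega>) = reward_diff m i k i' k' \<omega> - real m * (\<mu> k - \<mu> k')" for \<omega>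
    using i by (simp add: sum_coords Y_def s_def b_def reward_diff_def sum_negf sum_subtractf algebra_simps)
  ultimately show ?thesis by simp
qed

lemma reward_var_zero_AE:
  assumes "reward_var \<mu> \<nu> i k j = 0"
  shows "AE \<omega> in \<Omega>. \<omega> (X i k j) = \<mu> k"
proof -
  have E: "expectation (\<lambda>\<omega>. (\<omega> (X i k j) - \<mu> k)\<^sup>2) = 0"
    using integral_coord[of "\<lambda>x. (x - \<mu> k)\<^sup>2" i k j] assms by (simp add: reward_var_def)
  have "integrable \<Omega> (\<lambda>\<omega>. (\<omega> (X i k j) - \<mu> k)\<^sup>2)"
  proof (rule integrable_power_AE_bounded)
    show "AE \<omega> in \<Omega>. \<bar>\<omega> (X i k j) - \<mu> k\<bar> \<le> 1"
      using AE_coord[of i k j] by eventually_elim (use mean_in_unit[of k] in auto)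
  qed simp
  from integral_nonneg_eq_0_iff_AE[OF this] E show ?thesis by simp
qed

lemma prob_reward_diff_no_noise:
  assumes "\<And>i k j. reward_var \<mu> \<nu> i k j = 0"
  shows "prob {\<omega>. real m * (\<mu> k - \<mu> k') \<le> reward_diff m i k i' k' \<omega>} = 1"
proof -
  have "AE \<omega> in \<Omega>. \<forall>j. \<omega> (X i k j) = \<mu> k \<and> \<omega> (X i' k' j) = \<mu> k'"
    using reward_var_zero_AE[OF assms] by (simp add: AE_all_countable)
  then have "AE \<omega> in \<Omega>. \<omega> \<in> {\<omega>. real m * (\<mu> k - \<mu> k') \<le> reward_diff m i k i' k' \<omega>}"
    by eventually_elim (simp add: reward_diff_def algebra_simps)
  moreover have "{\<omega> \<in> space \<Omega>. real m * (\<mu> k - \<mu> k') \<le> reward_diff m i k i' k' \<omega>} \<in> sets \<Omega>" by measurable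
  ultimately show ?thesis by (subst prob_eq_1) auto
qed

lemma eventually_prob_pass_ge:
  assumes delta: "0 < \<delta>" "\<delta> \<le> \<mu> Optimal - \<mu> Inferior"
    and boundary: "\<delta> = \<mu> Optimal - \<mu> Inferior \<Longrightarrow> nondegenerate_noise \<mu> \<nu>"
  shows "\<exists>m0. \<forall>m\<ge>m0. \<forall>i i'. i \<noteq> i' \<longrightarrow> 1 / 7 \<le> prob {\<omega>. \<delta> * real m \<le> reward_diff m i Optimal i' Inferior \<omega>}"
proof (cases "\<delta> = \<mu> Optimal - \<mu> Inferior")
  case True
  from boundary[OF True] consider
      (noise) k v where "v > 0" "\<And>i j. v \<le> reward_var \<mu> \<nu> i k j"
    | (no_noise) "\<And>i k j. reward_var \<mu> \<nu> i k j = 0"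
    by (auto simp: nondegenerate_noise_def)
  then show ?thesis
  proof cases
    case noise
    show ?thesis
    proof (intro exI allI impI)
      \<comment> \<open>This \<open>m\<close> makes the variance contributed by the noisy type reach
        7; the other type only adds to it.\<close>
      fix m i i' assume m: "nat \<lceil>7 / v\<rceil> \<le> m" and i: "i \<noteq> (i' :: nat)"
      have nn: "0 \<le> reward_var \<mu> \<nu> i k j" for i k j by (auto simp: reward_var_def)
      have "7 \<le> real m * v" using m noise(1) by (simp add: field_simps)
      also have "\<dots> = (\<Sum>j = 1..m. v)" by simp
      finally have "7 \<le> (\<Sum>j = 1..m. reward_var \<mu> \<nu> i k j)" for i
        using sum_mono[of "{1..m}" "\<lambda>_. v" "\<lambda>j. reward_var \<mu> \<nu> i k j"] noise(2) by (meson order_trans)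
      from this[of i] this[of i'] have "7 \<le> (\<Sum>j = 1..m. reward_var \<mu> \<nu> i Optimal j) + (\<Sum>j = 1..m. reward_var \<mu> \<nu> i' Inferior j)"
        using sum_nonneg[of "{1..m}" "\<lambda>j. reward_var \<mu> \<nu> i Optimal j", OF nn]
          sum_nonneg[of "{1..m}" "\<lambda>j. reward_var \<mu> \<nu> i' Inferior j", OF nn]
        by (cases k) auto
      from prob_reward_diff_ge_mean[OF i this] show "1 / 7 \<le> prob {\<omega>. \<delta> * real m \<le> reward_diff m i Optimal i' Inferior \<omega>}"
        by (simp add: True mult.commute)
    qed
  next
    case no_noise
    then show ?thesis using prob_reward_diff_no_noise[OF no_noise, of _ Optimal Inferior] by (simp add: True mult.commute)
  qed
next
  case False
  define \<eta> where "\<eta> = \<mu> Optimal - \<mu> Inferior - \<delta>"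
  have \<eta>: "0 < \<eta>" using delta False by (simp add: \<eta>_def)
  show ?thesis
  proof (intro exI allI impI)
    \<comment> \<open>Below the gap the threshold lies \<open>m * \<eta>\<close> under the mean, and
      \<open>m * \<eta>\<^sup>2 >= 1\<close> already makes failure at most
      \<open>exp (-1)\<close>.\<close>
    fix m i i' assume m: "nat \<lceil>1 / \<eta>\<^sup>2\<rceil> + 1 \<le> m" and i: "i \<noteq> (i' :: nat)"
    have "1 / \<eta>\<^sup>2 \<le> real m" using m by linarith
    then have m1: "1 \<le> real m * \<eta>\<^sup>2" using \<eta> by (simp add: field_simps)
    have "prob {\<omega>. reward_diff m i Optimal i' Inferior \<omega> \<le> real m * (\<mu> Optimal - \<mu> Inferior) - real m * \<eta>}
        \<le> exp (- (real m * \<eta>)\<^sup>2 / real m)"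
      using m \<eta> i by (intro reward_diff_tails) auto
    also have "\<dots> = exp (- (real m * \<eta>\<^sup>2))"
      using m by (simp add: power2_eq_square)
    also have "\<dots> \<le> exp (-1)" using m1 by simp
    also have "\<dots> \<le> 6 / 7"
    proof -
      have "2 \<le> exp (1::real)" using exp_ge_add_one_self[of 1] by simp
      then show ?thesis by (simp add: exp_minus field_simps)
    qed
    finally have fail: "prob {\<omega>. reward_diff m i Optimal i' Inferior \<omega> \<le> \<delta> * real m} \<le> 6 / 7"
      by (simp add: \<eta>_def algebra_simps)
    have S: "{\<omega> \<in> space \<Omega>. \<delta> * real m \<le> reward_diff m i Optimal i' Inferior \<omega>} \<in> sets \<Omega>"
      "{\<omega> \<in> space \<Omega>. reward_diff m i Optimal i' Inferior \<omega> \<le> \<delta> * real m} \<in> sets \<Omega>" by measurable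
    have "1 - prob {\<omega>. \<delta> * real m \<le> reward_diff m i Optimal i' Inferior \<omega>}
        = prob (space \<Omega> - {\<omega>. \<delta> * real m \<le> reward_diff m i Optimal i' Inferior \<omega>})"
      using S by (subst prob_compl) auto
    also have "\<dots> \<le> prob {\<omega>. reward_diff m i Optimal i' Inferior \<omega> \<le> \<delta> * real m}"
      using S by (intro finite_measure_mono) auto
    finally show "1 / 7 \<le> prob {\<omega>. \<delta> * real m \<le> reward_diff m i Optimal i' Inferior \<omega>}"
      using fail by linarith
  qed
qed

end

section \<open>Expected regret\<close>

lemma depends_on_sample_of:
  assumes "\<And>\<sigma> \<sigma>'. (\<And>i. i \<in> I \<Longrightarrow> \<sigma> i = \<sigma>' i) \<Longrightarrow> f \<sigma> = f \<sigma>'"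
  shows "depends_on (\<lambda>\<omega>. f (sample_of \<omega>)) {x. arm_of x \<in> I}"
  unfolding depends_on_def by (auto intro!: assms simp: sample_of_def type_of_def)

lemma reward_sum_cong: "\<sigma> i = \<sigma>' i \<Longrightarrow> reward_sum m \<sigma> i = reward_sum m \<sigma>' i"
  by (simp add: reward_sum_def reward_def)

lemma epoch_reached_cong:
  assumes "\<And>i. i < 2 * k \<Longrightarrow> \<sigma> i = \<sigma>' i"
  shows "epoch_reached m \<delta> \<sigma> k = epoch_reached m \<delta> \<sigma>' k"
proof -
  have "epoch_fails m \<delta> \<sigma> e = epoch_fails m \<delta> \<sigma>' e" if "e < k" for e
    using that assms reward_sum_cong[of \<sigma> "2 * e" \<sigma>' m] reward_sum_cong[of \<sigma> "2 * e + 1" \<sigma>' m]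
    by (simp add: epoch_fails_def)
  then show ?thesis by (auto simp: epoch_reached_def)
qed

lemma epoch_reached_Suc:
  "epoch_reached m \<delta> \<sigma> (Suc k) \<longleftrightarrow> epoch_reached m \<delta> \<sigma> k \<and> epoch_fails m \<delta> \<sigma> k"
  by (auto simp: epoch_reached_def less_Suc_eq)

lemma sum_explore_arm:
  fixes f :: "nat \<Rightarrow> real"
  assumes "0 < m"
  shows "(\<Sum>l<2 * m. f (explore_arm m k l)) = real m * (f (2 * k) + f (2 * k + 1))"
proof -
  let ?B = "{l. l = 1 \<or> m < l}"
  have B: "{..<2 * m} \<inter> ?B = insert 1 {m + 1..<2 * m}" using assms by auto
  have "card ({..<2 * m} \<inter> ?B) = m" unfolding B using assms by simp
  moreover from this have "card ({..<2 * m} \<inter> - ?B) = m"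
    using card_Int_Diff[of "{..<2 * m}" ?B] by (simp add: Diff_eq)
  ultimately have "(\<Sum>l<2 * m. if l \<in> ?B then f (2 * k + 1) else f (2 * k)) = real m * (f (2 * k) + f (2 * k + 1))"
    by (subst sum.If_cases) (auto simp: algebra_simps)
  then show ?thesis by (simp add: explore_arm_def if_distrib[of f] cong: if_cong)
qed

lemma sum_div_mod_le:
  fixes f :: "nat \<Rightarrow> nat \<Rightarrow> real"
  assumes "0 < b" "\<And>k l. 0 \<le> f k l"
  shows "(\<Sum>t<n. f (t div b) (t mod b)) \<le> (\<Sum>k<n. \<Sum>l<b. f k l)"
proof -
  have "(\<Sum>t<n. f (t div b) (t mod b)) \<le> (\<Sum>t<n * b. f (t div b) (t mod b))"
    using assms by (intro sum_mono2) auto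
  also have "\<dots> = (\<Sum>k<n. \<Sum>t\<in>{k * b..<k * b + b}. f (t div b) (t mod b))"
    by (rule sum.nat_group[symmetric])
  also have "\<dots> = (\<Sum>k<n. \<Sum>l<b. f k l)"
  proof (rule sum.cong[OF refl])
    fix k
    show "(\<Sum>t\<in>{k * b..<k * b + b}. f (t div b) (t mod b)) = (\<Sum>l<b. f k l)"
      using assms(1)
      by (intro sum.reindex_bij_witness[of _ "\<lambda>l. k * b + l" "\<lambda>t. t - k * b"])
        (auto simp: mod_less div_less le_iff_add)
  qed
  finally show ?thesis .
qed

section \<open>Expected contributions of single plays and passing probabilities\<close>

context coordinates
begin

lemma measurable_reward [measurable (raw)]:
  assumes [measurable]: "f \<in> measurable M (bandit g \<nu>)"
  shows "(\<lambda>x. reward (f x) i j) \<in> borel_measurable M"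
proof -
  have "(\<lambda>\<sigma>. \<sigma> i) \<in> measurable (bandit g \<nu>) arm_space"
    by (subst measurable_cong_sets[OF sets_bandit refl]) (rule measurable_component_singleton, simp)
  moreover have "(\<lambda>y. snd y j) \<in> borel_measurable arm_space" by measurable
  ultimately have "(\<lambda>\<sigma>. snd (\<sigma> i) j) \<in> borel_measurable (bandit g \<nu>)"
    by (rule measurable_compose)
  from measurable_compose[OF assms this] show ?thesis by (simp add: reward_def)
qed

lemma measurable_reward_sum [measurable (raw)]:
  assumes [measurable]: "f \<in> measurable M (bandit g \<nu>)"
  shows "(\<lambda>x. reward_sum m (f x) i) \<in> borel_measurable M"
  unfolding reward_sum_def by measurable

lemma measurable_wins [measurable (raw)]:
  assumes [measurable]: "f \<in> measurable M (bandit g \<nu>)"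
  shows "Measurable.pred M (\<lambda>x. wins m \<delta> (f x) i i')"
  unfolding wins_def by measurable

lemma measurable_epoch_fails [measurable (raw)]:
  assumes [measurable]: "f \<in> measurable M (bandit g \<nu>)"
  shows "Measurable.pred M (\<lambda>x. epoch_fails m \<delta> (f x) e)"
  unfolding epoch_fails_def by measurable

lemma measurable_epoch_reached [measurable (raw)]:
  assumes [measurable]: "f \<in> measurable M (bandit g \<nu>)"
  shows "Measurable.pred M (\<lambda>x. epoch_reached m \<delta> (f x) k)"
  unfolding epoch_reached_def by measurable

lemma reward_sample_of: "reward (sample_of \<omega>) i j = \<omega> (X i (type_of \<omega> i) j)"
  by (simp add: reward_def sample_of_def)

lemma expectation_gap:
  shows "expectation (\<lambda>\<omega>. \<mu> Optimal - reward (sample_of \<omega>) i j) = (1 - g i) * (\<mu> Optimal - \<mu> Inferior)"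
    and "integrable \<Omega> (\<lambda>\<omega>. \<mu> Optimal - reward (sample_of \<omega>) i j)"
proof -
  define h :: "arm_type \<Rightarrow> arm_type \<Rightarrow> (coord \<Rightarrow> real) \<Rightarrow> real"
    where "h = (\<lambda>k k' \<omega>. \<mu> Optimal - \<omega> (X i k j))"
  have h: "integrable \<Omega> (h k k')" "expectation (h k k') = \<mu> Optimal - \<mu> k"
    "depends_on (h k k') {x. \<exists>i k j. x = X i k j}" for k k'
    by (auto simp: h_def depends_on_def prob_space[unfolded space_Omega])
  \<comment> \<open>Conditioning is set up for two arms; \<open>Suc i\<close> serves as a dummy
    second arm.\<close>
  have eq: "(\<lambda>\<omega>. \<mu> Optimal - reward (sample_of \<omega>) i j) = (\<lambda>\<omega>. h (type_of \<omega> i) (type_of \<omega> (Suc i)) \<omega>)"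
    by (simp add: h_def reward_sample_of)
  show "expectation (\<lambda>\<omega>. \<mu> Optimal - reward (sample_of \<omega>) i j) = (1 - g i) * (\<mu> Optimal - \<mu> Inferior)"
    unfolding eq by (subst expectation_types(1)[OF n_not_Suc_n h(1) h(3)])
      (simp add: h(2) UNIV_arm_type prob_type_of algebra_simps)
  show "integrable \<Omega> (\<lambda>\<omega>. \<mu> Optimal - reward (sample_of \<omega>) i j)"
    unfolding eq by (rule expectation_types(2)[OF n_not_Suc_n h(1) h(3)])
qed

text \<open>As \<open>m < j\<close>, given the types the reward is independent of the test, so its
  regret averages to the gap and vanishes for an optimal winner. For an inferior winner the
  difference has nonpositive mean whatever the opponent, so winning is a deviation of at least
  \<open>\<delta> * m\<close>.\<close>

lemma expectation_win:
  assumes i: "i \<noteq> i'" and m: "0 < m" "m < j" and \<delta>: "0 < \<delta>" and gap: "\<mu> Inferior < \<mu> Optimal"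
  shows "expectation (\<lambda>\<omega>. of_bool (wins m \<delta> (sample_of \<omega>) i i') * (\<mu> Optimal - reward (sample_of \<omega>) i j))
      \<le> (1 - g i) * (\<mu> Optimal - \<mu> Inferior) * exp (- (\<delta>\<^sup>2 * real m))"
proof -
  define W where "W k k' \<omega> = (of_bool (\<delta> * real m \<le> reward_diff m i k i' k' \<omega>) :: real)" for k k' \<omega>
  define h where "h = (\<lambda>k k' \<omega>. W k k' \<omega> * (\<mu> Optimal - \<omega> (X i k j)))"
  define p where "p k' = prob {\<omega>. type_of \<omega> i' = k'}" for k'
  have W: "expectation (W k k') = prob {\<omega>. \<delta> * real m \<le> reward_diff m i k i' k' \<omega>}" "integrable \<Omega> (W k k')" for k k'
    unfolding W_def[abs_def] by (intro expectation_of_bool; measurable)+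
  have hW: "expectation (h k k') = expectation (W k k') * (\<mu> Optimal - \<mu> k)" "integrable \<Omega> (h k k')" for k k'
  proof -
    have "depends_on (W k k') (coords m i k i' k')"
      by (auto simp: depends_on_def W_def reward_diff_def coords_def)
    moreover have "depends_on (\<lambda>\<omega>. \<mu> Optimal - \<omega> (X i k j)) {X i k j}"
      by (auto simp: depends_on_def)
    moreover have "coords m i k i' k' \<inter> {X i k j} = {}"
      using m i by (auto simp: coords_def)
    ultimately show "expectation (h k k') = expectation (W k k') * (\<mu> Optimal - \<mu> k)" "integrable \<Omega> (h k k')"
      unfolding h_def
      using block_expectation[OF W(2), of "\<lambda>\<omega>. \<mu> Optimal - \<omega> (X i k j)"] by (auto simp: prob_space[unfolded space_Omega])
  qed
  have dep: "depends_on (h k k') {x. \<exists>i k j. x = X i k j}" for k k'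
    by (auto simp: depends_on_def h_def W_def reward_diff_def)
  have bound: "expectation (W Inferior k') \<le> exp (- (\<delta>\<^sup>2 * real m))" for k'
  proof -
    have "\<mu> Inferior \<le> \<mu> k'" using gap by (cases k') auto
    then have le: "real m * (\<mu> Inferior - \<mu> k') \<le> 0" by (simp add: mult_nonneg_nonpos)
    have S: "{\<omega> \<in> space \<Omega>. real m * (\<mu> Inferior - \<mu> k') + \<delta> * real m \<le> reward_diff m i Inferior i' k' \<omega>} \<in> sets \<Omega>"
      by measurable
    have "expectation (W Inferior k') \<le> prob {\<omega>. real m * (\<mu> Inferior - \<mu> k') + \<delta> * real m \<le> reward_diff m i Inferior i' k' \<omega>}"
      unfolding W using S le by (intro finite_measure_mono) auto
    also have "\<dots> \<le> exp (- (\<delta> * real m)\<^sup>2 / real m)"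
      using i m \<delta> by (intro reward_diff_tails) auto
    also have "\<dots> = exp (- (\<delta>\<^sup>2 * real m))" using m by (simp add: power2_eq_square)
    finally show ?thesis .
  qed
  have eq: "(\<lambda>\<omega>. of_bool (wins m \<delta> (sample_of \<omega>) i i') * (\<mu> Optimal - reward (sample_of \<omega>) i j))
      = (\<lambda>\<omega>. h (type_of \<omega> i) (type_of \<omega> i') \<omega>)"
    by (simp add: h_def W_def wins_def reward_sum_sample_of reward_sample_of)
  have "expectation (\<lambda>\<omega>. of_bool (wins m \<delta> (sample_of \<omega>) i i') * (\<mu> Optimal - reward (sample_of \<omega>) i j))
      = (\<Sum>k'\<in>UNIV. p k' * ((1 - g i) * (\<mu> Optimal - \<mu> Inferior) * expectation (W Inferior k')))"
    unfolding eq by (subst expectation_types[OF i hW(2) dep])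
      (simp add: UNIV_arm_type hW(1) prob_type_of p_def algebra_simps)
  also have "\<dots> \<le> (\<Sum>k'\<in>UNIV. p k' * ((1 - g i) * (\<mu> Optimal - \<mu> Inferior) * exp (- (\<delta>\<^sup>2 * real m))))"
    using g01[of i] gap bound by (intro sum_mono mult_left_mono) (auto simp: p_def)
  also have "\<dots> = (1 - g i) * (\<mu> Optimal - \<mu> Inferior) * exp (- (\<delta>\<^sup>2 * real m))"
    by (simp add: UNIV_arm_type p_def prob_type_of algebra_simps)
  finally show ?thesis .
qed

lemma expectation_reached_mult:
  fixes f :: "sample \<Rightarrow> real"
  assumes int: "integrable \<Omega> (\<lambda>\<omega>. f (sample_of \<omega>))"
    and f: "\<And>\<sigma> \<sigma>'. (\<And>i. 2 * k \<le> i \<Longrightarrow> \<sigma> i = \<sigma>' i) \<Longrightarrow> f \<sigma> = f \<sigma>'"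
  shows "expectation (\<lambda>\<omega>. of_bool (epoch_reached m \<delta> (sample_of \<omega>) k) * f (sample_of \<omega>))
      = prob {\<omega>. epoch_reached m \<delta> (sample_of \<omega>) k} * expectation (\<lambda>\<omega>. f (sample_of \<omega>))"
    and "integrable \<Omega> (\<lambda>\<omega>. of_bool (epoch_reached m \<delta> (sample_of \<omega>) k) * f (sample_of \<omega>))"
proof -
  define b where "b \<sigma> = (of_bool (epoch_reached m \<delta> \<sigma> k) :: real)" for \<sigma>
  have b: "expectation (\<lambda>\<omega>. b (sample_of \<omega>)) = prob {\<omega>. epoch_reached m \<delta> (sample_of \<omega>) k}"
    "integrable \<Omega> (\<lambda>\<omega>. b (sample_of \<omega>))"
    unfolding b_def by (intro expectation_of_bool; measurable)+
  have "depends_on (\<lambda>\<omega>. b (sample_of \<omega>)) {x. arm_of x \<in> {..<2 * k}}"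
    unfolding b_def by (intro depends_on_sample_of arg_cong[where f = of_bool] epoch_reached_cong) auto
  moreover have "depends_on (\<lambda>\<omega>. f (sample_of \<omega>)) {x. arm_of x \<in> {2 * k..}}"
    by (intro depends_on_sample_of f) auto
  moreover have "{x. arm_of x \<in> {..<2 * k}} \<inter> {x. arm_of x \<in> {2 * k..}} = {}" by auto
  ultimately have "expectation (\<lambda>\<omega>. b (sample_of \<omega>) * f (sample_of \<omega>)) =
      expectation (\<lambda>\<omega>. b (sample_of \<omega>)) * expectation (\<lambda>\<omega>. f (sample_of \<omega>))"
    "integrable \<Omega> (\<lambda>\<omega>. b (sample_of \<omega>) * f (sample_of \<omega>))"
    using block_expectation[OF b(2) int] by auto
  then show "expectation (\<lambda>\<omega>. of_bool (epoch_reached m \<delta> (sample_of \<omega>) k) * f (sample_of \<omega>))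
      = prob {\<omega>. epoch_reached m \<delta> (sample_of \<omega>) k} * expectation (\<lambda>\<omega>. f (sample_of \<omega>))"
    "integrable \<Omega> (\<lambda>\<omega>. of_bool (epoch_reached m \<delta> (sample_of \<omega>) k) * f (sample_of \<omega>))"
    by (simp_all add: b_def[symmetric] b(1)[symmetric])
qed

text \<open>Only pairs of different types are credited with passing; the factor of \<open>q\<close>
  is the probability of such a pair. The two-sided test makes the order of the arms
  irrelevant.\<close>

lemma prob_epoch_fails:
  assumes pass: "\<And>i i'. i \<noteq> i' \<Longrightarrow> q \<le> prob {\<omega>. \<delta> * real m \<le> reward_diff m i Optimal i' Inferior \<omega>}"
  shows "prob {\<omega>. epoch_fails m \<delta> (sample_of \<omega>) e}
    \<le> 1 - q * (g (2 * e) * (1 - g (2 * e + 1)) + g (2 * e + 1) * (1 - g (2 * e)))"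
proof -
  define i where "i = 2 * e"
  define i' where "i' = 2 * e + 1"
  have ii: "i \<noteq> i'" by (simp add: i_def i'_def)
  define h where "h = (\<lambda>k k' \<omega>. (of_bool (\<bar>reward_diff m i k i' k' \<omega>\<bar> < \<delta> * real m) :: real))"
  have h: "expectation (h k k') = prob {\<omega>. \<bar>reward_diff m i k i' k' \<omega>\<bar> < \<delta> * real m}" "integrable \<Omega> (h k k')" for k k'
    unfolding h_def by (intro expectation_of_bool; measurable)+
  have dep: "depends_on (h k k') {x. \<exists>i k j. x = X i k j}" for k k'
    by (auto simp: depends_on_def h_def reward_diff_def)
  have E: "expectation (h k k') \<le> 1 - (if k = k' then 0 else q)" for k k'
  proof (cases "k = k'")
    case True
    then show ?thesis by (simp add: h)
  next
    case False
    have S: "{\<omega> \<in> space \<Omega>. \<bar>reward_diff m i k i' k' \<omega>\<bar> < \<delta> * real m} \<in> sets \<Omega>"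
      "{\<omega> \<in> space \<Omega>. \<delta> * real m \<le> reward_diff m i k i' k' \<omega>} \<in> sets \<Omega>"
      "{\<omega> \<in> space \<Omega>. \<delta> * real m \<le> reward_diff m i' k' i k \<omega>} \<in> sets \<Omega>" by measurable
    note S' = S sets.compl_sets[OF S(1)]
    have swap: "reward_diff m i' k' i k \<omega> = - reward_diff m i k i' k' \<omega>" for \<omega>
      by (simp add: reward_diff_def)
    have "q \<le> prob (space \<Omega> - {\<omega>. \<bar>reward_diff m i k i' k' \<omega>\<bar> < \<delta> * real m})"
    proof (cases k)
      case Optimal
      with False have "k' = Inferior" by (cases k') auto
      with Optimal have "q \<le> prob {\<omega>. \<delta> * real m \<le> reward_diff m i k i' k' \<omega>}" using pass ii by simp
      also have "\<dots> \<le> prob (space \<Omega> - {\<omega>. \<bar>reward_diff m i k i' k' \<omega>\<bar> < \<delta> * real m})"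
        using S' by (intro finite_measure_mono) auto
      finally show ?thesis .
    next
      case Inferior
      with False have "k' = Optimal" by (cases k') auto
      with Inferior have "q \<le> prob {\<omega>. \<delta> * real m \<le> reward_diff m i' k' i k \<omega>}" using pass ii by simp
      also have "\<dots> \<le> prob (space \<Omega> - {\<omega>. \<bar>reward_diff m i k i' k' \<omega>\<bar> < \<delta> * real m})"
        using S' by (intro finite_measure_mono) (auto simp: swap)
      finally show ?thesis .
    qed
    also have "\<dots> = 1 - expectation (h k k')"
      unfolding h using S by (subst prob_compl) auto
    finally show ?thesis using False by simp
  qed
  have "prob {\<omega>. epoch_fails m \<delta> (sample_of \<omega>) e} = expectation (\<lambda>\<omega>. of_bool (epoch_fails m \<delta> (sample_of \<omega>) e))"
    by (intro expectation_of_bool(1)[symmetric]) measurable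
  also have "(\<lambda>\<omega>. of_bool (epoch_fails m \<delta> (sample_of \<omega>) e)) = (\<lambda>\<omega>. h (type_of \<omega> i) (type_of \<omega> i') \<omega>)"
    by (simp add: h_def epoch_fails_def reward_sum_sample_of i_def i'_def)
  also have "expectation \<dots> = (\<Sum>k\<in>UNIV. \<Sum>k'\<in>UNIV. prob {\<omega>. type_of \<omega> i = k} * prob {\<omega>. type_of \<omega> i' = k'} * expectation (h k k'))"
    by (rule expectation_types[OF ii h(2) dep])
  also have "\<dots> \<le> (\<Sum>k\<in>UNIV. \<Sum>k'\<in>UNIV. prob {\<omega>. type_of \<omega> i = k} * prob {\<omega>. type_of \<omega> i' = k'} * (1 - (if k = k' then 0 else q)))"
    by (intro sum_mono mult_left_mono E) auto
  also have "\<dots> = 1 - q * (g i * (1 - g i') + g i' * (1 - g i))"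
    by (simp add: UNIV_arm_type prob_type_of algebra_simps)
  finally show ?thesis by (simp add: i_def i'_def)
qed

lemma prob_epoch_reached_Suc:
  assumes pass: "\<And>i i'. i \<noteq> i' \<Longrightarrow> 1 / 7 \<le> prob {\<omega>. \<delta> * real m \<le> reward_diff m i Optimal i' Inferior \<omega>}"
    and anti: "g (2 * k + 1) \<le> g (2 * k)"
  shows "prob {\<omega>. epoch_reached m \<delta> (sample_of \<omega>) (Suc k)}
    \<le> prob {\<omega>. epoch_reached m \<delta> (sample_of \<omega>) k} * (1 - g (2 * k + 1) * (2 - g (2 * k) - g (2 * k + 1)) / 7)"
proof -
  define f where "f \<sigma> = (of_bool (epoch_fails m \<delta> \<sigma> k) :: real)" for \<sigma>
  have f: "expectation (\<lambda>\<omega>. f (sample_of \<omega>)) = prob {\<omega>. epoch_fails m \<delta> (sample_of \<omega>) k}"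
    "integrable \<Omega> (\<lambda>\<omega>. f (sample_of \<omega>))"
    unfolding f_def by (intro expectation_of_bool; measurable)+
  have fcong: "f \<sigma> = f \<sigma>'" if "\<And>i. 2 * k \<le> i \<Longrightarrow> \<sigma> i = \<sigma>' i" for \<sigma> \<sigma>'
    using that reward_sum_cong[of \<sigma> "2 * k" \<sigma>' m] reward_sum_cong[of \<sigma> "2 * k + 1" \<sigma>' m]
    by (simp add: f_def epoch_fails_def)
  have "prob {\<omega>. epoch_reached m \<delta> (sample_of \<omega>) (Suc k)}
      = expectation (\<lambda>\<omega>. of_bool (epoch_reached m \<delta> (sample_of \<omega>) (Suc k)))"
    by (intro expectation_of_bool(1)[symmetric]) measurable
  also have "\<dots> = expectation (\<lambda>\<omega>. of_bool (epoch_reached m \<delta> (sample_of \<omega>) k) * f (sample_of \<omega>))"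
    by (simp add: epoch_reached_Suc f_def of_bool_conj)
  also have "\<dots> = prob {\<omega>. epoch_reached m \<delta> (sample_of \<omega>) k} * prob {\<omega>. epoch_fails m \<delta> (sample_of \<omega>) k}"
    using expectation_reached_mult(1)[OF f(2) fcong] by (simp add: f)
  also have "\<dots> \<le> prob {\<omega>. epoch_reached m \<delta> (sample_of \<omega>) k} * (1 - g (2 * k + 1) * (2 - g (2 * k) - g (2 * k + 1)) / 7)"
  proof (rule mult_left_mono)
    \<comment> \<open>Monotonicity of \<open>g\<close> bounds the probability of different types
      from below by a multiple of the expected number of inferior arms, the factor shared with the
      cost.\<close>
    have "0 \<le> (g (2 * k) - g (2 * k + 1)) * (1 - g (2 * k + 1))"
      using anti g01[of "2 * k + 1"] by simp
    then have "g (2 * k + 1) * (2 - g (2 * k) - g (2 * k + 1))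
        \<le> g (2 * k) * (1 - g (2 * k + 1)) + g (2 * k + 1) * (1 - g (2 * k))"
      by (simp add: algebra_simps)
    moreover have "prob {\<omega>. epoch_fails m \<delta> (sample_of \<omega>) k}
        \<le> 1 - 1 / 7 * (g (2 * k) * (1 - g (2 * k + 1)) + g (2 * k + 1) * (1 - g (2 * k)))"
      by (rule prob_epoch_fails) (rule pass)
    ultimately show "prob {\<omega>. epoch_fails m \<delta> (sample_of \<omega>) k}
        \<le> 1 - g (2 * k + 1) * (2 - g (2 * k) - g (2 * k + 1)) / 7"
      by (simp add: field_simps)
  qed auto
  finally show ?thesis .
qed

text \<open>In \<open>real m + 1\<close> the summand \<open>real m\<close> is exploration, where
  each arm of an epoch is pulled \<open>m\<close> times, and 1 collects the commitments, which
  contribute at most a fraction \<open>1 / n\<close> at each of the \<open>n\<close> times.\<close>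

lemma expected_regret_le:
  fixes n :: nat and \<delta> :: real
  defines "m \<equiv> epoch_pulls n \<delta>"
  assumes n: "2 \<le> n" and \<delta>: "0 < \<delta>" and gap: "\<mu> Inferior < \<mu> Optimal"
  shows "expected_regret \<mu> g \<nu> (alg1 n \<delta>) n \<le> (\<mu> Optimal - \<mu> Inferior) * (real m + 1) *
    (\<Sum>k<n. (2 - g (2 * k) - g (2 * k + 1)) * prob {\<omega>. epoch_reached m \<delta> (sample_of \<omega>) k})"
proof -
  define \<Delta> where "\<Delta> = \<mu> Optimal - \<mu> Inferior"
  define P where "P k = prob {\<omega>. epoch_reached m \<delta> (sample_of \<omega>) k}" for k
  define u where "u k = 2 - g (2 * k) - g (2 * k + 1)" for k
  have \<Delta>: "0 < \<Delta>" using gap by (simp add: \<Delta>_def)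
  have P: "0 \<le> P k" for k by (simp add: P_def)
  have u: "0 \<le> u k" for k using g01[of "2 * k"] g01[of "2 * k + 1"] by (simp add: u_def)
  have "0 < 2 * ln (real n) / \<delta>\<^sup>2" using n \<delta> by simp
  then have m: "0 < m" by (simp add: m_def epoch_pulls_def)
  have "2 * ln (real n) / \<delta>\<^sup>2 \<le> real m"
    unfolding m_def epoch_pulls_def by (rule real_nat_ceiling_ge)
  then have "2 * ln (real n) \<le> \<delta>\<^sup>2 * real m" using \<delta> by (simp add: field_simps)
  moreover have "0 \<le> ln (real n)" using n by simp
  \<comment> \<open>The choice of \<open>m\<close> even gives \<open>1 / n^2\<close>; the bound
    \<open>1 / n\<close> suffices for a sum over \<open>n\<close> plays.\<close>
  ultimately have "exp (- (\<delta>\<^sup>2 * real m)) \<le> exp (- ln (real n))" by simp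
  then have small: "exp (- (\<delta>\<^sup>2 * real m)) \<le> 1 / real n"
    using n by (simp add: exp_minus inverse_eq_divide)
  define A where "A k l \<sigma> = of_bool (epoch_reached m \<delta> \<sigma> k) *
      (\<mu> Optimal - reward \<sigma> (explore_arm m k l) (Suc (explore_pulls m k l (explore_arm m k l))))" for k l \<sigma>
  define C where "C e i i' j \<sigma> = of_bool (epoch_reached m \<delta> \<sigma> e) *
      (of_bool (wins m \<delta> \<sigma> i i') * (\<mu> Optimal - reward \<sigma> i j))" for e i i' j \<sigma>
  define J where "J t e = Suc (m + (t - 2 * m * Suc e))" for t e
  define R where "R \<sigma> = (\<Sum>t<n. A (t div (2 * m)) (t mod (2 * m)) \<sigma> + (\<Sum>e<t div (2 * m).
      C e (2 * e) (2 * e + 1) (J t e) \<sigma> + C e (2 * e + 1) (2 * e) (J t e) \<sigma>))" for \<sigma>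
  have regret: "regret \<mu> (alg1 n \<delta>) \<sigma> n = R \<sigma>" for \<sigma>
    unfolding regret_eq R_def
  proof (rule sum.cong[OF refl])
    fix t
    have l: "t mod (2 * m) < 2 * m" using m by simp
    have t: "t = 2 * m * (t div (2 * m)) + t mod (2 * m)" by simp
    show "\<mu> Optimal - reward \<sigma> (played (alg1 n \<delta>) \<sigma> t) (Suc (pulls (history (alg1 n \<delta>) \<sigma> t) (played (alg1 n \<delta>) \<sigma> t))) =
      A (t div (2 * m)) (t mod (2 * m)) \<sigma> + (\<Sum>e<t div (2 * m).
        C e (2 * e) (2 * e + 1) (J t e) \<sigma> + C e (2 * e + 1) (2 * e) (J t e) \<sigma>)"
      using regret_term[OF m[unfolded m_def] \<delta> l[unfolded m_def] t[unfolded m_def], of "\<mu> Optimal" \<sigma>]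
      unfolding A_def C_def J_def m_def[symmetric] by (simp add: distrib_left)
  qed
  have [measurable]: "R \<in> borel_measurable (bandit g \<nu>)"
    unfolding R_def A_def C_def by measurable
  have EA: "expectation (\<lambda>\<omega>. A k l (sample_of \<omega>)) = P k * (\<Delta> * (1 - g (explore_arm m k l)))"
    "integrable \<Omega> (\<lambda>\<omega>. A k l (sample_of \<omega>))" for k l
  proof -
    define f where "f \<sigma> = \<mu> Optimal - reward \<sigma> (explore_arm m k l) (Suc (explore_pulls m k l (explore_arm m k l)))" for \<sigma>
    have "f \<sigma> = f \<sigma>'" if "\<And>i. 2 * k \<le> i \<Longrightarrow> \<sigma> i = \<sigma>' i" for \<sigma> \<sigma>'
      using that by (simp add: f_def reward_def explore_arm_def)
    from expectation_reached_mult[OF _ this, of "\<lambda>\<sigma>. \<sigma>"] expectation_gap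
    show "expectation (\<lambda>\<omega>. A k l (sample_of \<omega>)) = P k * (\<Delta> * (1 - g (explore_arm m k l)))"
      "integrable \<Omega> (\<lambda>\<omega>. A k l (sample_of \<omega>))"
      by (simp_all add: A_def f_def P_def \<Delta>_def mult.commute)
  qed
  have EC: "expectation (\<lambda>\<omega>. C e i i' (J t e) (sample_of \<omega>)) \<le> P e * (\<Delta> * (1 - g i) / real n)"
    "integrable \<Omega> (\<lambda>\<omega>. C e i i' (J t e) (sample_of \<omega>))"
    if i: "2 * e \<le> i" "2 * e \<le> i'" "i \<noteq> i'" for e i i' t
  proof -
    define f where "f \<sigma> = of_bool (wins m \<delta> \<sigma> i i') * (\<mu> Optimal - reward \<sigma> i (J t e))" for \<sigma>
    have f: "integrable \<Omega> (\<lambda>\<omega>. f (sample_of \<omega>))"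
      unfolding f_def by (intro integrable_of_bool_mult expectation_gap) measurable
    have cong: "f \<sigma> = f \<sigma>'" if "\<And>i. 2 * e \<le> i \<Longrightarrow> \<sigma> i = \<sigma>' i" for \<sigma> \<sigma>'
      using that i reward_sum_cong[of \<sigma> i \<sigma>' m] reward_sum_cong[of \<sigma> i' \<sigma>' m]
      by (simp add: f_def reward_def wins_def)
    have "expectation (\<lambda>\<omega>. f (sample_of \<omega>)) \<le> \<Delta> * (1 - g i) * exp (- (\<delta>\<^sup>2 * real m))"
      using expectation_win[OF i(3) m _ \<delta> gap, of "J t e"] by (simp add: f_def J_def \<Delta>_def mult_ac)
    also have "\<dots> \<le> \<Delta> * (1 - g i) * (1 / real n)"
      using small \<Delta> g01[of i] by (intro mult_left_mono) auto
    finally have "P e * expectation (\<lambda>\<omega>. f (sample_of \<omega>)) \<le> P e * (\<Delta> * (1 - g i) / real n)"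
      using P[of e] by (intro mult_left_mono) auto
    with expectation_reached_mult[OF f cong]
    show "expectation (\<lambda>\<omega>. C e i i' (J t e) (sample_of \<omega>)) \<le> P e * (\<Delta> * (1 - g i) / real n)"
      "integrable \<Omega> (\<lambda>\<omega>. C e i i' (J t e) (sample_of \<omega>))"
      by (simp_all add: C_def f_def P_def)
  qed
  have intC [simp]: "integrable \<Omega> (\<lambda>\<omega>. C e (2 * e) (2 * e + 1) (J t e) (sample_of \<omega>))"
    "integrable \<Omega> (\<lambda>\<omega>. C e (2 * e + 1) (2 * e) (J t e) (sample_of \<omega>))" for e t
    by (intro EC(2); simp)+
  have "expected_regret \<mu> g \<nu> (alg1 n \<delta>) n = expectation (\<lambda>\<omega>. R (sample_of \<omega>))"
    unfolding expected_regret_def regret by (subst bandit_eq_distr, subst integral_distr) auto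
  also have "\<dots> = (\<Sum>t<n. expectation (\<lambda>\<omega>. A (t div (2 * m)) (t mod (2 * m)) (sample_of \<omega>)) +
      (\<Sum>e<t div (2 * m). expectation (\<lambda>\<omega>. C e (2 * e) (2 * e + 1) (J t e) (sample_of \<omega>)) +
        expectation (\<lambda>\<omega>. C e (2 * e + 1) (2 * e) (J t e) (sample_of \<omega>))))"
    unfolding R_def using EA(2) intC by (simp del: One_nat_def)
  also have "\<dots> \<le> (\<Sum>t<n. P (t div (2 * m)) * (\<Delta> * (1 - g (explore_arm m (t div (2 * m)) (t mod (2 * m))))) +
      (\<Sum>e<n. \<Delta> / real n * (u e * P e)))"
  proof (intro sum_mono add_mono)
    fix t assume t: "t \<in> {..<n}"
    show "expectation (\<lambda>\<omega>. A (t div (2 * m)) (t mod (2 * m)) (sample_of \<omega>))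
        \<le> P (t div (2 * m)) * (\<Delta> * (1 - g (explore_arm m (t div (2 * m)) (t mod (2 * m)))))"
      by (simp add: EA)
    have "(\<Sum>e<t div (2 * m). expectation (\<lambda>\<omega>. C e (2 * e) (2 * e + 1) (J t e) (sample_of \<omega>)) +
        expectation (\<lambda>\<omega>. C e (2 * e + 1) (2 * e) (J t e) (sample_of \<omega>))) \<le> (\<Sum>e<t div (2 * m). \<Delta> / real n * (u e * P e))"
    proof (rule sum_mono)
      fix e
      have "P e * (\<Delta> * (1 - g (2 * e)) / real n) + P e * (\<Delta> * (1 - g (2 * e + 1)) / real n) = \<Delta> / real n * (u e * P e)"
        by (simp add: u_def add_divide_distrib[symmetric] algebra_simps)
      then show "expectation (\<lambda>\<omega>. C e (2 * e) (2 * e + 1) (J t e) (sample_of \<omega>)) +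
          expectation (\<lambda>\<omega>. C e (2 * e + 1) (2 * e) (J t e) (sample_of \<omega>)) \<le> \<Delta> / real n * (u e * P e)"
        using EC(1)[of e "2 * e" "2 * e + 1" t] EC(1)[of e "2 * e + 1" "2 * e" t] by simp
    qed
    also have "\<dots> \<le> (\<Sum>e<n. \<Delta> / real n * (u e * P e))"
    proof (rule sum_mono2)
      have "t div (2 * m) < n" using t by (intro le_less_trans[OF div_le_dividend]) simp
      then show "{..<t div (2 * m)} \<subseteq> {..<n}" by auto
    qed (use \<Delta> u P in auto)
    finally show "(\<Sum>e<t div (2 * m). expectation (\<lambda>\<omega>. C e (2 * e) (2 * e + 1) (J t e) (sample_of \<omega>)) +
        expectation (\<lambda>\<omega>. C e (2 * e + 1) (2 * e) (J t e) (sample_of \<omega>))) \<le> (\<Sum>e<n. \<Delta> / real n * (u e * P e))" .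
  qed
  also have "\<dots> = (\<Sum>t<n. P (t div (2 * m)) * (\<Delta> * (1 - g (explore_arm m (t div (2 * m)) (t mod (2 * m))))))
      + \<Delta> * (\<Sum>e<n. u e * P e)"
    using n by (simp only: sum.distrib sum_distrib_left[symmetric]) simp
  \<comment> \<open>Completes a truncated last epoch and allows \<open>n\<close> epochs; both only
    add nonnegative terms.\<close>
  also have "(\<Sum>t<n. P (t div (2 * m)) * (\<Delta> * (1 - g (explore_arm m (t div (2 * m)) (t mod (2 * m))))))
      \<le> (\<Sum>k<n. \<Sum>l<2 * m. P k * (\<Delta> * (1 - g (explore_arm m k l))))"
    using m P \<Delta> g01 by (intro sum_div_mod_le[where f = "\<lambda>k l. P k * (\<Delta> * (1 - g (explore_arm m k l)))"]) auto
  also have "\<dots> = (\<Sum>k<n. \<Delta> * real m * (u k * P k))"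
  proof (rule sum.cong[OF refl])
    fix k
    have "(\<Sum>l<2 * m. P k * (\<Delta> * (1 - g (explore_arm m k l)))) = P k * (\<Delta> * (\<Sum>l<2 * m. 1 - g (explore_arm m k l)))"
      by (simp only: sum_distrib_left)
    also have "\<dots> = \<Delta> * real m * (u k * P k)"
      by (subst sum_explore_arm[OF m]) (simp add: u_def)
    finally show "(\<Sum>l<2 * m. P k * (\<Delta> * (1 - g (explore_arm m k l)))) = \<Delta> * real m * (u k * P k)" .
  qed
  also have "\<dots> + \<Delta> * (\<Sum>e<n. u e * P e) = \<Delta> * (real m + 1) * (\<Sum>k<n. u k * P k)"
    by (simp add: sum_distrib_left[symmetric] algebra_simps)
  finally show ?thesis by (simp add: \<Delta>_def u_def P_def)
qed

end

theorem theorem4: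
  fixes \<mu> :: "arm_type \<Rightarrow> real"
    and \<nu> :: "nat \<Rightarrow> arm_type \<Rightarrow> nat \<Rightarrow> real measure"
    and c \<gamma> \<delta> \<Delta> :: real
    and g :: "nat \<Rightarrow> real"
  assumes gap: "\<mu> Optimal > \<mu> Inferior"
    and Delta: "\<Delta> = \<mu> Optimal - \<mu> Inferior"
    and rewards: "reward_laws \<mu> \<nu>"
    and c: "0 < c" "c < 1"
    and gamma: "0 \<le> \<gamma>" "\<gamma> < 1"
    and delta: "0 < \<delta>" "\<delta> \<le> \<Delta>"
    and boundary: "\<delta> = \<Delta> \<Longrightarrow> nondegenerate_noise \<mu> \<nu>"
    and g: "\<And>u. g u = c * (real u + 1) powr (- \<gamma>)"
  shows "limsup (\<lambda>n. ereal (expected_regret \<mu> g \<nu> (alg1 n \<delta>) n / ln (real n)))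
    \<le> ereal (48 * \<Delta> / \<delta>\<^sup>2 * (4 / c) powr (1 / (1 - \<gamma>)) * fact (nat \<lceil>\<gamma> / (1 - \<gamma>)\<rceil>))"
proof -
  have g_anti: "g j \<le> g i" if "i \<le> j" for i j
    unfolding g using c gamma that by (intro mult_left_mono powr_mono2') auto
  have g01: "0 \<le> g i" "g i \<le> 1" for i
  proof -
    show "0 \<le> g i" using c by (simp add: g)
    have "g i \<le> g 0" by (rule g_anti) simp
    moreover have "g 0 = c" by (simp add: g)
    ultimately show "g i \<le> 1" using c by linarith
  qed
  interpret coordinates \<mu> g \<nu>
    by unfold_locales (use rewards g01 in auto)
  define K where "K = 24 * (4 / c) powr (1 / (1 - \<gamma>)) * fact (nat \<lceil>\<gamma> / (1 - \<gamma>)\<rceil>)"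
  have K: "0 \<le> K" by (simp add: K_def)
  have D: "0 < \<Delta>" using gap Delta by simp
  obtain m0 where m0: "\<And>m i i'. m0 \<le> m \<Longrightarrow> i \<noteq> i' \<Longrightarrow>
      1 / 7 \<le> prob {\<omega>. \<delta> * real m \<le> reward_diff m i Optimal i' Inferior \<omega>}"
    using eventually_prob_pass_ge[of \<delta>] delta boundary Delta by blast
  have lim_ln: "filterlim (\<lambda>n. 2 * ln (real n) / \<delta>\<^sup>2) at_top sequentially"
    using delta by real_asymp
  have "eventually (\<lambda>n. real m0 \<le> 2 * ln (real n) / \<delta>\<^sup>2) sequentially"
    using lim_ln by (auto simp: filterlim_at_top)
  then have "eventually (\<lambda>n. expected_regret \<mu> g \<nu> (alg1 n \<delta>) n / ln (real n)
      \<le> \<Delta> * (2 * ln (real n) / \<delta>\<^sup>2 + 2) * K / ln (real n)) sequentially"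
    using eventually_ge_at_top[of 2]
  proof eventually_elim
    case (elim n)
    define m where "m = epoch_pulls n \<delta>"
    have ln: "0 < ln (real n)" using elim by simp
    then have "0 \<le> 2 * ln (real n) / \<delta>\<^sup>2" by simp
    then have m: "2 * ln (real n) / \<delta>\<^sup>2 \<le> real m" "real m \<le> 2 * ln (real n) / \<delta>\<^sup>2 + 1"
      unfolding m_def epoch_pulls_def by linarith+
    then have "m0 \<le> m" using elim by linarith
    \<comment> \<open>\<open>P\<close> varies with \<open>n\<close> through \<open>m\<close>, but
      the bound \<open>K\<close> does not, so only the prefactor \<open>m + 1\<close> grows with
      \<open>n\<close>.\<close>
    define P where "P k = prob {\<omega>. epoch_reached m \<delta> (sample_of \<omega>) k}" for k
    have "(\<Sum>k<n. (2 - g (2 * k) - g (2 * k + 1)) * P k) \<le> K"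
      unfolding K_def
    proof (rule reservoir_sum_le[OF c gamma g])
      show "P (Suc k) \<le> P k * (1 - g (2 * k + 1) * (2 - g (2 * k) - g (2 * k + 1)) / 7)" for k
        unfolding P_def by (rule prob_epoch_reached_Suc) (use m0[OF \<open>m0 \<le> m\<close>] g_anti in auto)
    qed (auto simp: P_def)
    then have "\<Delta> * (real m + 1) * (\<Sum>k<n. (2 - g (2 * k) - g (2 * k + 1)) * P k) \<le> \<Delta> * (2 * ln (real n) / \<delta>\<^sup>2 + 2) * K"
    proof (intro mult_mono)
      have "0 \<le> 2 - g (2 * k) - g (2 * k + 1)" for k
        using g01(2)[of "2 * k"] g01(2)[of "2 * k + 1"] by linarith
      then show "0 \<le> (\<Sum>k<n. (2 - g (2 * k) - g (2 * k + 1)) * P k)"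
        by (intro sum_nonneg mult_nonneg_nonneg) (auto simp: P_def)
    qed (use m D \<open>0 \<le> 2 * ln (real n) / \<delta>\<^sup>2\<close> in auto)
    then have "expected_regret \<mu> g \<nu> (alg1 n \<delta>) n \<le> \<Delta> * (2 * ln (real n) / \<delta>\<^sup>2 + 2) * K"
      using expected_regret_le[OF \<open>2 \<le> n\<close> delta(1) gap] by (simp add: Delta P_def m_def)
    then show ?case using ln by (simp add: divide_right_mono)
  qed
  then have "limsup (\<lambda>n. ereal (expected_regret \<mu> g \<nu> (alg1 n \<delta>) n / ln (real n)))
      \<le> limsup (\<lambda>n. ereal (\<Delta> * (2 * ln (real n) / \<delta>\<^sup>2 + 2) * K / ln (real n)))"
    by (intro Limsup_mono) (auto elim: eventually_mono)
  also have "\<dots> = ereal (\<Delta> * (2 / \<delta>\<^sup>2) * K)"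
  proof (rule lim_imp_Limsup)
    have "(\<lambda>n. \<Delta> * (2 * ln (real n) / \<delta>\<^sup>2 + 2) * K / ln (real n)) \<longlonglongrightarrow> \<Delta> * (2 / \<delta>\<^sup>2) * K"
      unfolding divide_inverse using delta by real_asymp
    then show "(\<lambda>n. ereal (\<Delta> * (2 * ln (real n) / \<delta>\<^sup>2 + 2) * K / ln (real n))) \<longlonglongrightarrow> ereal (\<Delta> * (2 / \<delta>\<^sup>2) * K)"
      by simp
  qed simp
  also have "\<Delta> * (2 / \<delta>\<^sup>2) * K = 48 * \<Delta> / \<delta>\<^sup>2 * (4 / c) powr (1 / (1 - \<gamma>)) * fact (nat \<lceil>\<gamma> / (1 - \<gamma>)\<rceil>)"
    by (simp add: K_def)
  finally show ?thesis .
qed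

end
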